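(* Let $\sigma$ be an order-two $*$-automorphism of a unital C*-algebra $A$, and let $W$ be the canonical unitary of $A\rtimes_\sigma\mathbb{Z}_2$. Then the C*-crossed-product $A\rtimes_\sigma\mathbb{Z}_2$ is $*$-isomorphic to $$\left\{\begin{pmatrix}a&b\\ \sigma(b)&\sigma(a)\end{pmatrix}:a,b\in A\right\}\subseteq M_2(A)$$ via the isomorphism determined by $a\in A\mapsto\begin{pmatrix}a&0\\0&\sigma(a)\end{pmatrix}$ and $W\mapsto\begin{pmatrix}0&1\\1&0\end{pmatrix}$.
   Context: For an order-two $*$-automorphism $\sigma$ of a unital C*-algebra $A$, the crossed-product $A\rtimes_\sigma\mathbb{Z}_2$ is the universal unital C*-algebra generated by $A$ and a unitary $W$ (the canonical unitary) subject to $W^2=1$ and $WaW^*=\sigma(a)$ for all $a\in A$: any unital $*$-morphism $\psi:A\to B$ into a unital C*-algebra $B$ containing a unitary $u$ with $u^2=1$ and $u\psi(a)u^*=\psi(\sigma(a))$ for all $a\in A$ extends uniquely to $A\rtimes_\sigma\mathbb{Z}_2$ with $\psi(W)=u$. *)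

theory Defs
  imports
    "HOL-Algebra.Module"
    "HOL-Algebra.Subrings"
    "HOL-Algebra.QuotRing"
    "HOL-Analysis.Finite_Cartesian_Product"
    "HOL-Analysis.Abstract_Metric_Spaces"
begin

text \<open>
  C*-algebras are carrier-based records on top of HOL-Algebra, because the universal property
  of the crossed product quantifies over all C*-algebras of a type inside a formula, which type
  classes do not allow.  All algebras are unital and all *-morphisms are unital.
\<close>

record 'a star_alg = "(complex, 'a) module" +
  star :: "'a \<Rightarrow> 'a"

record 'a cstar = "'a star_alg" +
  nrm :: "'a \<Rightarrow> real"

definition complex_ring :: "complex ring" where
  "complex_ring = \<lparr>carrier = UNIV, monoid.mult = (*), one = 1, ring.zero = 0, add = (+)\<rparr>"

locale star_algebra =
  Ring.ring A + scalars: Module.module complex_ring A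
  for A :: "('a, 'm) star_alg_scheme" (structure) +
  assumes smult_mult_left:
      "\<lbrakk>x \<in> carrier A; y \<in> carrier A\<rbrakk> \<Longrightarrow> (c \<odot> x) \<otimes> y = c \<odot> (x \<otimes> y)"
    and smult_mult_right:
      "\<lbrakk>x \<in> carrier A; y \<in> carrier A\<rbrakk> \<Longrightarrow> x \<otimes> (c \<odot> y) = c \<odot> (x \<otimes> y)"
    and star_closed: "x \<in> carrier A \<Longrightarrow> star A x \<in> carrier A"
    and star_star: "x \<in> carrier A \<Longrightarrow> star A (star A x) = x"
    and star_add:
      "\<lbrakk>x \<in> carrier A; y \<in> carrier A\<rbrakk> \<Longrightarrow> star A (x \<oplus> y) = star A x \<oplus> star A y"
    and star_mult:
      "\<lbrakk>x \<in> carrier A; y \<in> carrier A\<rbrakk> \<Longrightarrow> star A (x \<otimes> y) = star A y \<otimes> star A x"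
    and star_smult: "x \<in> carrier A \<Longrightarrow> star A (c \<odot> x) = cnj c \<odot> star A x"

text \<open>
  The value 0 off the carrier is only there because \<^locale>\<open>Metric_space\<close> wants a distance that
  is nonnegative and symmetric on the whole type.
\<close>
definition cstar_dist :: "('a, 'm) cstar_scheme \<Rightarrow> 'a \<Rightarrow> 'a \<Rightarrow> real" where
  "cstar_dist A x y =
     (if x \<in> carrier A \<and> y \<in> carrier A then nrm A (x \<ominus>\<^bsub>A\<^esub> y) else 0)"

locale cstar_algebra = star_algebra A for A :: "('a, 'm) cstar_scheme" (structure) +
  assumes nrm_nonneg: "x \<in> carrier A \<Longrightarrow> 0 \<le> nrm A x"
    and nrm_eq_0: "x \<in> carrier A \<Longrightarrow> nrm A x = 0 \<longleftrightarrow> x = \<zero>"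
    and nrm_add: "\<lbrakk>x \<in> carrier A; y \<in> carrier A\<rbrakk> \<Longrightarrow> nrm A (x \<oplus> y) \<le> nrm A x + nrm A y"
    and nrm_smult: "x \<in> carrier A \<Longrightarrow> nrm A (c \<odot> x) = cmod c * nrm A x"
    and nrm_mult: "\<lbrakk>x \<in> carrier A; y \<in> carrier A\<rbrakk> \<Longrightarrow> nrm A (x \<otimes> y) \<le> nrm A x * nrm A y"
    and cstar_identity: "x \<in> carrier A \<Longrightarrow> nrm A (star A x \<otimes> x) = (nrm A x)\<^sup>2"
    and complete: "Metric_space.mcomplete (carrier A) (cstar_dist A)"

lemma (in cstar_algebra) Metric_space_cstar_dist: "Metric_space (carrier A) (cstar_dist A)"
proof
  have minus_one: "\<ominus> x = (-1) \<odot> x" if x: "x \<in> carrier A" for x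
  proof -
    have sc: "carrier complex_ring = UNIV"
         "\<zero>\<^bsub>complex_ring\<^esub> = (0 :: complex)"
         "\<one>\<^bsub>complex_ring\<^esub> = (1 :: complex)"
         "\<And>a b :: complex. a \<oplus>\<^bsub>complex_ring\<^esub> b = a + b"
      by (simp_all add: complex_ring_def)
    have "(-1) \<odot> x \<oplus> x = ((-1) + 1) \<odot> x"
      using scalars.smult_l_distr[of "-1" 1 x] scalars.smult_one[of x] x by (simp add: sc)
    also have "\<dots> = \<zero>"
      using scalars.smult_l_null[of x] x by (simp add: sc)
    finally show ?thesis
      by (rule minus_equality) (use x scalars.smult_closed[of "-1" x] in \<open>simp_all add: sc\<close>)
  qed
  have swap: "nrm A (x \<ominus> y) = nrm A (y \<ominus> x)" if xy: "x \<in> carrier A" "y \<in> carrier A" for x y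
  proof -
    have "x \<ominus> y = \<ominus> (y \<ominus> x)"
      using xy by (simp add: a_minus_def minus_add a_comm)
    then show ?thesis
      using nrm_smult[of "y \<ominus> x" "-1"] minus_one[of "y \<ominus> x"] xy by simp
  qed
  fix x y z
  show "0 \<le> cstar_dist A x y"
    by (simp add: cstar_dist_def nrm_nonneg)
  show "cstar_dist A x y = cstar_dist A y x"
    by (simp add: cstar_dist_def swap)
  assume xy: "x \<in> carrier A" "y \<in> carrier A"
  then show "cstar_dist A x y = 0 \<longleftrightarrow> x = y"
    by (simp add: cstar_dist_def nrm_eq_0)
  assume z: "z \<in> carrier A"
  have "x \<ominus> z = (x \<ominus> y) \<oplus> (y \<ominus> z)"
    using xy z by (simp add: a_minus_def a_assoc r_neg2 l_neg r_neg1)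
  then show "cstar_dist A x z \<le> cstar_dist A x y + cstar_dist A y z"
    using nrm_add[of "x \<ominus> y" "y \<ominus> z"] xy z by (simp add: cstar_dist_def)
qed

definition star_hom ::
  "('a, 'm) star_alg_scheme \<Rightarrow> ('b, 'n) star_alg_scheme \<Rightarrow> ('a \<Rightarrow> 'b) set" where
  "star_hom A B = {\<psi> \<in> ring_hom A B.
     (\<forall>c. \<forall>x \<in> carrier A. \<psi> (c \<odot>\<^bsub>A\<^esub> x) = c \<odot>\<^bsub>B\<^esub> \<psi> x) \<and>
     (\<forall>x \<in> carrier A. \<psi> (star A x) = star B (\<psi> x))}"

definition star_iso ::
  "('a, 'm) star_alg_scheme \<Rightarrow> ('b, 'n) star_alg_scheme \<Rightarrow> ('a \<Rightarrow> 'b) set" where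
  "star_iso A B = {\<psi> \<in> star_hom A B. bij_betw \<psi> (carrier A) (carrier B)}"

definition order_two_star_automorphism ::
  "('a, 'm) star_alg_scheme \<Rightarrow> ('a \<Rightarrow> 'a) \<Rightarrow> bool" where
  "order_two_star_automorphism A \<sigma> \<longleftrightarrow>
     \<sigma> \<in> star_iso A A \<and>
     (\<forall>a \<in> carrier A. \<sigma> (\<sigma> a) = a) \<and> (\<exists>a \<in> carrier A. \<sigma> a \<noteq> a)"

definition star_subalgebra :: "'a set \<Rightarrow> ('a, 'm) star_alg_scheme \<Rightarrow> bool" where
  "star_subalgebra S A \<longleftrightarrow> subring S A \<and>
     (\<forall>c. \<forall>x \<in> S. c \<odot>\<^bsub>A\<^esub> x \<in> S) \<and> (\<forall>x \<in> S. star A x \<in> S)"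

definition cstar_generated :: "('a, 'm) cstar_scheme \<Rightarrow> 'a set \<Rightarrow> 'a set" where
  "cstar_generated A G = Inter {S. star_subalgebra S A \<and>
     closedin (Metric_space.mtopology (carrier A) (cstar_dist A)) S \<and> G \<subseteq> S}"

definition unitary :: "('a, 'm) star_alg_scheme \<Rightarrow> 'a \<Rightarrow> bool" where
  "unitary A u \<longleftrightarrow>
     u \<in> carrier A \<and> star A u \<otimes>\<^bsub>A\<^esub> u = \<one>\<^bsub>A\<^esub> \<and> u \<otimes>\<^bsub>A\<^esub> star A u = \<one>\<^bsub>A\<^esub>"

definition covariant_pair ::
  "('a, 'm) star_alg_scheme \<Rightarrow> ('a \<Rightarrow> 'a) \<Rightarrow> ('b, 'n) star_alg_scheme \<Rightarrow>
   ('a \<Rightarrow> 'b) \<Rightarrow> 'b \<Rightarrow> bool" where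
  "covariant_pair A \<sigma> B \<psi> u \<longleftrightarrow>
     \<psi> \<in> star_hom A B \<and> unitary B u \<and> u \<otimes>\<^bsub>B\<^esub> u = \<one>\<^bsub>B\<^esub> \<and>
     (\<forall>a \<in> carrier A. u \<otimes>\<^bsub>B\<^esub> \<psi> a \<otimes>\<^bsub>B\<^esub> star B u = \<psi> (\<sigma> a))"

text \<open>
  \<open>C\<close> is a crossed product of \<open>A\<close> by \<open>\<sigma>\<close>, with canonical unitary \<open>W\<close>; the injective *-morphism
  \<open>\<iota>\<close> is the inclusion of \<open>A\<close> into the C*-algebra generated by \<open>A\<close> and \<open>W\<close>.

  The test algebras \<open>B\<close> range over all C*-algebras whose carrier lies in the type of \<open>C\<close>.
  Up to isomorphism this is no restriction: for a covariant pair \<open>(\<psi>, u)\<close> in any C*-algebra,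
  the C*-subalgebra generated by its image is \<open>{\<psi> a + \<psi> b u | a b. a, b in A}\<close>, whose
  cardinality is at most that of \<open>A\<close> squared, hence (\<open>\<iota>\<close> being injective, and a nonzero
  C*-algebra being infinite) at most that of the carrier of \<open>C\<close>.
\<close>
definition crossed_product_Z2 ::
  "'a cstar \<Rightarrow> ('a \<Rightarrow> 'a) \<Rightarrow> 'c cstar \<Rightarrow> ('a \<Rightarrow> 'c) \<Rightarrow> 'c \<Rightarrow> bool" where
  "crossed_product_Z2 A \<sigma> C \<iota> W \<longleftrightarrow>
     cstar_algebra C \<and>
     inj_on \<iota> (carrier A) \<and>
     covariant_pair A \<sigma> C \<iota> W \<and>
     cstar_generated C (insert W (\<iota> ` carrier A)) = carrier C \<and>
     (\<forall>(B :: 'c cstar) \<psi> u. cstar_algebra B \<and> covariant_pair A \<sigma> B \<psi> u \<longrightarrow>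
        (\<exists>\<Phi> \<in> star_hom C B.
           (\<forall>a \<in> carrier A. \<Phi> (\<iota> a) = \<psi> a) \<and> \<Phi> W = u \<and>
           (\<forall>\<Phi>' \<in> star_hom C B. (\<forall>a \<in> carrier A. \<Phi>' (\<iota> a) = \<psi> a) \<and> \<Phi>' W = u \<longrightarrow>
              (\<forall>x \<in> carrier C. \<Phi>' x = \<Phi> x))))"

text \<open>
  \<open>M_2(A)\<close> as a *-algebra.  Its C*-norm is not recorded, since *-isomorphisms are bijective
  *-morphisms and do not mention norms.
\<close>
definition mat2_alg :: "('a, 'm) star_alg_scheme \<Rightarrow> ('a ^ 2 ^ 2) star_alg" where
  "mat2_alg A = \<lparr>
     carrier = {P. \<forall>i j. P $ i $ j \<in> carrier A},
     monoid.mult = (\<lambda>P Q. \<chi> i j. finsum A (\<lambda>k. P $ i $ k \<otimes>\<^bsub>A\<^esub> Q $ k $ j) UNIV),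
     one = (\<chi> i j. if i = j then \<one>\<^bsub>A\<^esub> else \<zero>\<^bsub>A\<^esub>),
     ring.zero = (\<chi> i j. \<zero>\<^bsub>A\<^esub>),
     add = (\<lambda>P Q. \<chi> i j. P $ i $ j \<oplus>\<^bsub>A\<^esub> Q $ i $ j),
     smult = (\<lambda>c P. \<chi> i j. c \<odot>\<^bsub>A\<^esub> P $ i $ j),
     star = (\<lambda>P. \<chi> i j. star A (P $ j $ i)) \<rparr>"

text \<open>The matrix with rows \<open>(a, b)\<close> and \<open>(c, d)\<close>; \<open>vector\<close> would need a zero on the type.\<close>
definition mat2 :: "'a \<Rightarrow> 'a \<Rightarrow> 'a \<Rightarrow> 'a \<Rightarrow> 'a ^ 2 ^ 2" where
  "mat2 a b c d =
     (\<chi> i j. if i = 1 then (if j = 1 then a else b) else (if j = 1 then c else d))"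

definition twisted_matrices :: "('a, 'm) star_alg_scheme \<Rightarrow> ('a \<Rightarrow> 'a) \<Rightarrow> ('a ^ 2 ^ 2) set" where
  "twisted_matrices A \<sigma> = {mat2 a b (\<sigma> b) (\<sigma> a) | a b. a \<in> carrier A \<and> b \<in> carrier A}"

definition twisted_matrix_alg ::
  "('a, 'm) star_alg_scheme \<Rightarrow> ('a \<Rightarrow> 'a) \<Rightarrow> ('a ^ 2 ^ 2) star_alg" where
  "twisted_matrix_alg A \<sigma> = (mat2_alg A)\<lparr>carrier := twisted_matrices A \<sigma>\<rparr>"

end

theory Submission
  imports Defs "HOL-Analysis.Cartesian_Space"
begin

text \<open>
  By the relations every element of the *-algebra generated by \<open>A\<close> and \<open>W\<close> has the form
  \<open>a + b W\<close>, and such elements multiply like the matrices in the theorem.  The dual automorphism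
  \<open>a + b W \<mapsto> a - b W\<close>, which comes from the universal property, is contractive and so bounds
  \<open>\<parallel>a\<parallel>\<close> and \<open>\<parallel>b\<parallel>\<close> by \<open>\<parallel>a + b W\<parallel>\<close>.  Hence the representation is unique, and the elements
  \<open>a + b W\<close> form a complete subspace because the injective *-morphism \<open>\<iota>\<close> is isometric; so they
  exhaust the crossed product.

  That *-morphisms are contractive, and isometric if injective, is proved without spectral theory,
  from square roots of \<open>1 - w\<close> and the inequality \<open>\<parallel>h\<parallel>\<^sup>2 \<le> \<parallel>h\<^sup>2 + q\<^sup>2\<parallel>\<close> for commuting self-adjoint
  \<open>h\<close> and \<open>q\<close>.
\<close>

section \<open>Norm and limits in a C*-algebra\<close>

lemma complex_ring_simps [simp]:
  "carrier complex_ring = UNIV" "\<zero>\<^bsub>complex_ring\<^esub> = 0" "\<one>\<^bsub>complex_ring\<^esub> = 1"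
  "a \<oplus>\<^bsub>complex_ring\<^esub> b = a + b" "a \<otimes>\<^bsub>complex_ring\<^esub> b = a * b"
  by (simp_all add: complex_ring_def)

section \<open>Algebraic identities for scalars, differences and the involution\<close>

context star_algebra
begin

lemma smult_closed [simp]: "x \<in> carrier A \<Longrightarrow> c \<odot> x \<in> carrier A"
  using scalars.smult_closed[of c x] by simp

lemma smult_add_left: "x \<in> carrier A \<Longrightarrow> (c + d) \<odot> x = c \<odot> x \<oplus> d \<odot> x"
  using scalars.smult_l_distr[of c d x] by simp

lemma smult_add_right:
  "x \<in> carrier A \<Longrightarrow> y \<in> carrier A \<Longrightarrow> c \<odot> (x \<oplus> y) = c \<odot> x \<oplus> c \<odot> y"
  using scalars.smult_r_distr[of c x y] by simp

lemma smult_smult [simp]: "x \<in> carrier A \<Longrightarrow> c \<odot> (d \<odot> x) = (c * d) \<odot> x"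
  using scalars.smult_assoc1[of c d x] by simp

lemma smult_one_left [simp]: "x \<in> carrier A \<Longrightarrow> 1 \<odot> x = x"
  using scalars.smult_one[of x] by simp

lemma smult_zero_left [simp]: "x \<in> carrier A \<Longrightarrow> 0 \<odot> x = \<zero>"
  using scalars.smult_l_null[of x] by simp

lemma smult_zero_right [simp]: "c \<odot> \<zero> = \<zero>"
  using scalars.smult_r_null[of c] by simp

lemma minus_eq_smult: "x \<in> carrier A \<Longrightarrow> \<ominus> x = (-1) \<odot> x"
  by (rule minus_equality) (use smult_add_left[of x "-1" 1] in simp_all)

lemma smult_minus: "x \<in> carrier A \<Longrightarrow> c \<odot> (\<ominus> x) = \<ominus> (c \<odot> x)"
  by (simp add: minus_eq_smult)

lemma smult_diff:
  "x \<in> carrier A \<Longrightarrow> y \<in> carrier A \<Longrightarrow> c \<odot> (x \<ominus> y) = c \<odot> x \<ominus> c \<odot> y"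
  by (simp add: a_minus_def smult_add_right smult_minus)

declare star_closed [simp] star_star [simp]

lemma star_minus: "x \<in> carrier A \<Longrightarrow> star A (\<ominus> x) = \<ominus> star A x"
  by (simp add: minus_eq_smult star_smult)

lemma star_diff:
  "x \<in> carrier A \<Longrightarrow> y \<in> carrier A \<Longrightarrow> star A (x \<ominus> y) = star A x \<ominus> star A y"
  by (simp add: a_minus_def star_add star_minus)

lemma star_one [simp]: "star A \<one> = \<one>"
  using star_mult[of "star A \<one>" \<one>] by simp

lemma diff_add_diff:
  "x \<in> carrier A \<Longrightarrow> y \<in> carrier A \<Longrightarrow> z \<in> carrier A \<Longrightarrow> (x \<ominus> y) \<oplus> (y \<ominus> z) = x \<ominus> z"
  by algebra

lemma diff_mult:
  "x \<in> carrier A \<Longrightarrow> y \<in> carrier A \<Longrightarrow> z \<in> carrier A \<Longrightarrow> (x \<ominus> y) \<otimes> z = x \<otimes> z \<ominus> y \<otimes> z"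
  by algebra

lemma mult_diff:
  "x \<in> carrier A \<Longrightarrow> y \<in> carrier A \<Longrightarrow> z \<in> carrier A \<Longrightarrow> z \<otimes> (x \<ominus> y) = z \<otimes> x \<ominus> z \<otimes> y"
  by algebra

end

context cstar_algebra
begin

section \<open>The norm and limits of sequences\<close>

lemma nrm_zero [simp]: "nrm A \<zero> = 0"
  by (simp add: nrm_eq_0)

lemma nrm_minus: "x \<in> carrier A \<Longrightarrow> nrm A (\<ominus> x) = nrm A x"
  by (simp add: minus_eq_smult nrm_smult)

lemma nrm_diff: "x \<in> carrier A \<Longrightarrow> y \<in> carrier A \<Longrightarrow> nrm A (x \<ominus> y) \<le> nrm A x + nrm A y"
  using nrm_add[of x "\<ominus> y"] by (simp add: a_minus_def nrm_minus)

lemma nrm_diff_commute: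
  assumes "x \<in> carrier A" "y \<in> carrier A"
  shows "nrm A (x \<ominus> y) = nrm A (y \<ominus> x)"
  using Metric_space.commute[OF Metric_space_cstar_dist, of x y] assms
  by (simp add: cstar_dist_def)

lemma nrm_diff_triangle:
  "x \<in> carrier A \<Longrightarrow> y \<in> carrier A \<Longrightarrow> z \<in> carrier A \<Longrightarrow>
    nrm A (x \<ominus> z) \<le> nrm A (x \<ominus> y) + nrm A (y \<ominus> z)"
  using nrm_add[of "x \<ominus> y" "y \<ominus> z"] by (simp add: diff_add_diff)

text \<open>The C*-identity and submultiplicativity give \<open>nrm A y\<close> squared \<le>
  \<open>nrm A (star A y) * nrm A y\<close>. Cancelling one factor, for \<open>x\<close> and for
  \<open>star A x\<close>, yields both inequalities.\<close>

lemma nrm_star [simp]: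
  assumes x: "x \<in> carrier A"
  shows "nrm A (star A x) = nrm A x"
proof -
  have le: "nrm A y \<le> nrm A (star A y)" if y: "y \<in> carrier A" for y
  proof (cases "nrm A y = 0")
    case True
    then show ?thesis using y by (simp add: nrm_nonneg)
  next
    case False
    have "nrm A y * nrm A y \<le> nrm A (star A y) * nrm A y"
      using nrm_mult[of "star A y" y] y by (simp add: cstar_identity power2_eq_square)
    with False nrm_nonneg[OF y] show ?thesis by simp
  qed
  show ?thesis
    using le[of x] le[of "star A x"] x by simp
qed

lemma nrm_selfadjoint_square:
  "x \<in> carrier A \<Longrightarrow> star A x = x \<Longrightarrow> nrm A (x \<otimes> x) = (nrm A x)\<^sup>2"
  using cstar_identity[of x] by simp

text \<open>By the C*-identity the norm of the unit is idempotent. The value 0 occurs in the zero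
  algebra, so only an inequality is available.\<close>

lemma nrm_one: "nrm A \<one> \<le> 1"
proof -
  have "nrm A \<one> = (nrm A \<one>)\<^sup>2"
    using cstar_identity[of \<one>] by simp
  then have "nrm A \<one> = 0 \<or> nrm A \<one> = 1"
    by (simp add: power2_eq_square)
  then show ?thesis
    by auto
qed

lemma nrm_diff_mult:
  assumes "x \<in> carrier A" "y \<in> carrier A" "x' \<in> carrier A" "y' \<in> carrier A"
  shows "nrm A (x \<otimes> y \<ominus> x' \<otimes> y') \<le> nrm A x * nrm A (y \<ominus> y') + nrm A (x \<ominus> x') * nrm A y'"
proof -
  have "nrm A (x \<otimes> y \<ominus> x' \<otimes> y') \<le> nrm A (x \<otimes> y \<ominus> x \<otimes> y') + nrm A (x \<otimes> y' \<ominus> x' \<otimes> y')"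
    using assms by (intro nrm_diff_triangle) auto
  also have "\<dots> = nrm A (x \<otimes> (y \<ominus> y')) + nrm A ((x \<ominus> x') \<otimes> y')"
    using assms by (simp add: diff_mult mult_diff)
  also have "\<dots> \<le> nrm A x * nrm A (y \<ominus> y') + nrm A (x \<ominus> x') * nrm A y'"
    using assms by (intro add_mono nrm_mult) auto
  finally show ?thesis .
qed

text \<open>Restates completeness through the norm alone, so that later limit arguments are about
  real sequences.\<close>

lemma Cauchy_imp_convergent:
  assumes f: "\<And>n. f n \<in> carrier A"
    and Cauchy: "\<And>\<epsilon>. 0 < \<epsilon> \<Longrightarrow> \<exists>N. \<forall>m\<ge>N. \<forall>n\<ge>N. nrm A (f m \<ominus> f n) < \<epsilon>"
  obtains l where "l \<in> carrier A" "(\<lambda>n. nrm A (f n \<ominus> l)) \<longlonglongrightarrow> 0"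
proof -
  interpret M: Metric_space "carrier A" "cstar_dist A"
    by (rule Metric_space_cstar_dist)
  have "M.MCauchy f"
    unfolding M.MCauchy_def using f Cauchy by (auto simp: cstar_dist_def)
  then obtain l where "limitin M.mtopology f l sequentially"
    using complete unfolding M.mcomplete_def by blast
  then have "l \<in> carrier A \<and> (\<lambda>n. nrm A (f n \<ominus> l)) \<longlonglongrightarrow> 0"
    using f by (auto simp: M.limitin_metric_dist_null cstar_dist_def)
  then show ?thesis
    using that by blast
qed

text \<open>The tool for identities satisfied by a limit: both sides are shown to be limits of one
  sequence.\<close>

lemma limit_unique:
  assumes f: "\<And>n. f n \<in> carrier A" and l: "l \<in> carrier A" "l' \<in> carrier A"
    and "(\<lambda>n. nrm A (f n \<ominus> l)) \<longlonglongrightarrow> 0" "(\<lambda>n. nrm A (f n \<ominus> l')) \<longlonglongrightarrow> 0"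
  shows "l = l'"
proof -
  have "(\<lambda>n. nrm A (f n \<ominus> l) + nrm A (f n \<ominus> l')) \<longlonglongrightarrow> 0 + 0"
    using assms by (intro tendsto_add)
  moreover have "nrm A (l \<ominus> l') \<le> nrm A (f n \<ominus> l) + nrm A (f n \<ominus> l')" for n
    using nrm_diff_triangle[of l "f n" l'] nrm_diff_commute[of l "f n"] f l by simp
  ultimately have "nrm A (l \<ominus> l') \<le> 0"
    by (intro LIMSEQ_le_const) auto
  then have "nrm A (l \<ominus> l') = 0"
    using nrm_nonneg[of "l \<ominus> l'"] l by simp
  then show ?thesis
    using l by (simp add: nrm_eq_0)
qed

text \<open>The sum of squares is \<open>u* u\<close> for \<open>u = h + iq\<close>, and \<open>h\<close> is the real part of \<open>u\<close>.\<close>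
lemma nrm_square_le_nrm_sum_squares:
  assumes h: "h \<in> carrier A" "star A h = h" and q: "q \<in> carrier A" "star A q = q"
    and comm: "h \<otimes> q = q \<otimes> h"
  shows "(nrm A h)\<^sup>2 \<le> nrm A (h \<otimes> h \<oplus> q \<otimes> q)"
proof -
  define u where "u = h \<oplus> \<i> \<odot> q"
  have u: "u \<in> carrier A"
    using h q by (simp add: u_def)
  have su: "star A u = h \<ominus> \<i> \<odot> q"
    using h q by (simp add: u_def star_add star_smult a_minus_def minus_eq_smult)
  \<comment> \<open>Commutativity of \<open>h\<close> and \<open>q\<close> makes the two cross terms
    equal, so that they cancel.\<close>
  have "star A u \<otimes> u = (h \<otimes> h \<ominus> \<i> \<odot> (h \<otimes> q)) \<oplus> (\<i> \<odot> (h \<otimes> q) \<ominus> (-1) \<odot> (q \<otimes> q))"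
    unfolding su using h q comm
    by (simp add: u_def diff_mult r_distr smult_mult_left smult_mult_right smult_diff)
  also have "\<dots> = h \<otimes> h \<oplus> q \<otimes> q"
  proof -
    have "(p \<ominus> z) \<oplus> (z \<ominus> \<ominus> r) = p \<oplus> r"
      if "p \<in> carrier A" "z \<in> carrier A" "r \<in> carrier A" for p z r
      using that by algebra
    then show ?thesis
      using h q by (simp add: minus_eq_smult[symmetric])
  qed
  finally have "(nrm A u)\<^sup>2 = nrm A (h \<otimes> h \<oplus> q \<otimes> q)"
    using cstar_identity[OF u] by simp
  moreover have "nrm A h \<le> nrm A u"
  proof -
    have "u \<oplus> star A u = h \<oplus> h"
      unfolding su unfolding u_def using h q
      by (simp add: ring_simprules)
    also have "\<dots> = 2 \<odot> h"
      using smult_add_left[of h 1 1] h by simp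
    finally have "2 * nrm A h = nrm A (u \<oplus> star A u)"
      using h by (simp add: nrm_smult)
    also have "\<dots> \<le> 2 * nrm A u"
      using nrm_add[of u "star A u"] u by simp
    finally show ?thesis by simp
  qed
  ultimately show ?thesis
    using nrm_nonneg[OF h(1)] by (metis power_mono)
qed

end

section \<open>Square roots\<close>

text \<open>
  The scalar case of the iteration for square roots below, which it dominates in norm.
\<close>
primrec sqrt_bound :: "nat \<Rightarrow> real" where
  "sqrt_bound 0 = 0"
| "sqrt_bound (Suc n) = (1 + (sqrt_bound n)\<^sup>2) / 2"

lemma sqrt_bound_range: "0 \<le> sqrt_bound n \<and> sqrt_bound n \<le> 1"
proof (induction n)
  case (Suc n)
  then have "(sqrt_bound n)\<^sup>2 \<le> 1"
    by (simp add: power_le_one)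
  then show ?case
    by simp
qed simp

text \<open>The sequence is bounded by 1, and it increases because each increment is half the square
  of \<open>sqrt_bound n - 1\<close>.\<close>

lemma convergent_sqrt_bound: "convergent sqrt_bound"
proof (rule Bseq_mono_convergent)
  show "Bseq sqrt_bound"
    using sqrt_bound_range by (intro BseqI'[of _ 1]) simp
  have "sqrt_bound n \<le> sqrt_bound (Suc n)" for n
    using zero_le_power2[of "sqrt_bound n - 1"] by (simp add: power2_diff)
  then show "\<forall>m n. m \<le> n \<longrightarrow> sqrt_bound m \<le> sqrt_bound n"
    by (simp add: lift_Suc_mono_le)
qed

context cstar_algebra
begin

text \<open>
  \<open>s = 1 - t\<close> squares to \<open>1 - w\<close> iff \<open>t = (w + t\<^sup>2) / 2\<close>; the fixed point is the limit of
  the iteration started at \<open>0\<close>.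
\<close>
lemma sqrt_exists:
  assumes w: "w \<in> carrier A" "star A w = w" "nrm A w \<le> 1"
  obtains s where "s \<in> carrier A" "star A s = s" "s \<otimes> s = \<one> \<ominus> w" "nrm A (\<one> \<ominus> s) \<le> 1"
    "\<And>y. y \<in> carrier A \<Longrightarrow> w \<otimes> y = y \<otimes> w \<Longrightarrow> s \<otimes> y = y \<otimes> s"
proof -
  define t where "t = rec_nat \<zero> (\<lambda>_ x. (1 / 2) \<odot> (w \<oplus> x \<otimes> x))"
  have t_simps: "t 0 = \<zero>" "t (Suc n) = (1 / 2) \<odot> (w \<oplus> t n \<otimes> t n)" for n
    by (simp_all add: t_def)
  have tc [simp]: "t n \<in> carrier A" for n
    by (induction n) (use w in \<open>simp_all add: t_simps\<close>)
  have star_zero: "star A \<zero> = \<zero>"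
    using star_smult[of \<zero> 0] by simp
  have t_star: "star A (t n) = t n" for n
    by (induction n) (use w star_zero in \<open>simp_all add: t_simps star_smult star_add star_mult\<close>)
  \<comment> \<open>Each iterate is built from \<open>w\<close> by sums, products and scalars, so it
    commutes with whatever commutes with \<open>w\<close>. The limit inherits this, which supplies
    the commutation hypotheses of \<open>nrm_square_le_nrm_sum_squares\<close> later on.\<close>
  have t_comm: "t n \<otimes> y = y \<otimes> t n" if y: "y \<in> carrier A" "w \<otimes> y = y \<otimes> w" for n y
  proof (induction n)
    case (Suc n)
    have "t n \<otimes> t n \<otimes> y = y \<otimes> (t n \<otimes> t n)"
      using Suc.IH y m_assoc[of "t n" "t n" y] m_assoc[of "t n" y "t n"] m_assoc[of y "t n" "t n"]
      by simp
    then show ?case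
      using y w by (simp add: t_simps smult_mult_left smult_mult_right l_distr r_distr)
  qed (use y in \<open>simp add: t_simps\<close>)
  have t_nrm: "nrm A (t n) \<le> sqrt_bound n" for n
  proof (induction n)
    case (Suc n)
    have "nrm A (w \<oplus> t n \<otimes> t n) \<le> nrm A w + nrm A (t n) * nrm A (t n)"
      using nrm_add[of w "t n \<otimes> t n"] nrm_mult[of "t n" "t n"] w by simp
    also have "\<dots> \<le> 1 + (sqrt_bound n)\<^sup>2"
      using w Suc.IH nrm_nonneg[of "t n"] sqrt_bound_range[of n]
      by (auto simp: power2_eq_square intro!: add_mono mult_mono)
    finally show ?case
      using w by (simp add: t_simps nrm_smult)
  qed (simp add: t_simps)
  \<comment> \<open>The next increment is half of a difference of squares;
    \<open>nrm_diff_mult\<close> bounds it by the corresponding scalar expression.\<close>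
  have t_step: "nrm A (t (Suc n) \<ominus> t n) \<le> sqrt_bound (Suc n) - sqrt_bound n" for n
  proof (induction n)
    case 0
    then show ?case
      using w by (simp add: t_simps a_minus_def nrm_smult)
  next
    case (Suc n)
    let ?x = "t (Suc n)" and ?y = "t n"
    have "t (Suc (Suc n)) \<ominus> ?x = (1 / 2) \<odot> ((w \<oplus> ?x \<otimes> ?x) \<ominus> (w \<oplus> ?y \<otimes> ?y))"
      using arg_cong2[where f = "\<lambda>a b. a \<ominus> b", OF t_simps(2)[of "Suc n"] t_simps(2)[of n]] w
      by (simp add: smult_diff)
    also have "(w \<oplus> ?x \<otimes> ?x) \<ominus> (w \<oplus> ?y \<otimes> ?y) = ?x \<otimes> ?x \<ominus> ?y \<otimes> ?y"
    proof -
      have "(w \<oplus> a) \<ominus> (w \<oplus> b) = a \<ominus> b" if "a \<in> carrier A" "b \<in> carrier A" for a b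
        using that w(1) by algebra
      then show ?thesis by simp
    qed
    finally have "2 * nrm A (t (Suc (Suc n)) \<ominus> ?x) = nrm A (?x \<otimes> ?x \<ominus> ?y \<otimes> ?y)"
      by (simp add: nrm_smult)
    also have "\<dots> \<le> nrm A ?x * nrm A (?x \<ominus> ?y) + nrm A (?x \<ominus> ?y) * nrm A ?y"
      by (intro nrm_diff_mult) auto
    also have "\<dots> \<le> sqrt_bound (Suc n) * (sqrt_bound (Suc n) - sqrt_bound n)
                   + (sqrt_bound (Suc n) - sqrt_bound n) * sqrt_bound n"
      using Suc.IH t_nrm[of n] t_nrm[of "Suc n"] sqrt_bound_range[of n] sqrt_bound_range[of "Suc n"]
        nrm_nonneg[of ?x] nrm_nonneg[of ?y] nrm_nonneg[of "?x \<ominus> ?y"]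
      by (intro add_mono mult_mono) (auto simp del: t_simps sqrt_bound.simps)
    \<comment> \<open>The left side is the difference of the squares of two consecutive bounds. Only
      the last \<open>sqrt_bound (Suc n)\<close>, the fifth match, is to be unfolded; the others
      stay as they are.\<close>
    also have "\<dots> = 2 * (sqrt_bound (Suc (Suc n)) - sqrt_bound (Suc n))"
      unfolding sqrt_bound.simps(2)[of "Suc n"]
      by (subst (5) sqrt_bound.simps(2)) (simp add: power2_eq_square algebra_simps)
    finally show ?case
      by (simp del: sqrt_bound.simps)
  qed
  \<comment> \<open>The step bounds telescope, so \<open>t\<close> is Cauchy because
    \<open>sqrt_bound\<close> is.\<close>
  have t_diff: "nrm A (t (n + k) \<ominus> t n) \<le> sqrt_bound (n + k) - sqrt_bound n" for n k
  proof (induction k)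
    case 0
    then show ?case by (simp add: a_minus_def r_neg)
  next
    case (Suc k)
    then show ?case
      using t_step[of "n + k"] nrm_diff_triangle[of "t (Suc (n + k))" "t (n + k)" "t n"]
      by (simp del: sqrt_bound.simps)
  qed
  have "\<exists>N. \<forall>m\<ge>N. \<forall>n\<ge>N. nrm A (t m \<ominus> t n) < \<epsilon>" if "0 < \<epsilon>" for \<epsilon>
  proof -
    have "Cauchy sqrt_bound"
      using convergent_sqrt_bound by (rule convergent_Cauchy)
    then obtain N where N: "\<bar>sqrt_bound m - sqrt_bound n\<bar> < \<epsilon>" if "N \<le> m" "N \<le> n" for m n
      using \<open>0 < \<epsilon>\<close> unfolding Cauchy_def dist_real_def by blast
    have "nrm A (t m \<ominus> t n) < \<epsilon>" if "N \<le> m" "N \<le> n" for m n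
    proof (cases "n \<le> m")
      case True
      then show ?thesis
        using t_diff[of n "m - n"] N[OF that] by simp
    next
      case False
      then show ?thesis
        using t_diff[of m "n - m"] N[OF that] nrm_diff_commute[of "t m" "t n"] by simp
    qed
    then show ?thesis
      by blast
  qed
  then obtain l where l [simp]: "l \<in> carrier A" and lim: "(\<lambda>n. nrm A (t n \<ominus> l)) \<longlonglongrightarrow> 0"
    using Cauchy_imp_convergent[of t, OF tc] by metis
  have le_1: "nrm A (t n) \<le> 1" for n
    using t_nrm[of n] sqrt_bound_range[of n] by simp
  have l_nrm: "nrm A l \<le> 1"
  proof -
    have "(\<lambda>n. 1 + nrm A (t n \<ominus> l)) \<longlonglongrightarrow> 1 + 0"
      by (intro tendsto_intros lim)
    moreover have "nrm A l \<le> 1 + nrm A (t n \<ominus> l)" for n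
    proof -
      have "nrm A l = nrm A (t n \<ominus> (t n \<ominus> l))"
      proof -
        have "x \<ominus> (x \<ominus> y) = y" if "x \<in> carrier A" "y \<in> carrier A" for x y
          using that by algebra
        then show ?thesis by simp
      qed
      also have "\<dots> \<le> nrm A (t n) + nrm A (t n \<ominus> l)"
        by (intro nrm_diff) auto
      finally show ?thesis
        using le_1[of n] by simp
    qed
    ultimately show ?thesis
      using LIMSEQ_le_const by fastforce
  qed
  have l_star: "star A l = l"
  proof (rule limit_unique[of t])
    have "nrm A (t n \<ominus> star A l) = nrm A (t n \<ominus> l)" for n
      using star_diff[of "t n" l] nrm_star[of "t n \<ominus> l"] by (simp add: t_star)
    then show "(\<lambda>n. nrm A (t n \<ominus> star A l)) \<longlonglongrightarrow> 0"
      using lim by simp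
  qed (use lim in auto)
  have l_comm: "l \<otimes> y = y \<otimes> l" if y: "y \<in> carrier A" "w \<otimes> y = y \<otimes> w" for y
  proof (rule limit_unique[of "\<lambda>n. t n \<otimes> y"])
    have 1: "(\<lambda>n. nrm A (t n \<ominus> l) * nrm A y) \<longlonglongrightarrow> 0 * nrm A y"
      by (intro tendsto_intros lim)
    have 2: "nrm A (t n \<otimes> y \<ominus> l \<otimes> y) \<le> nrm A (t n \<ominus> l) * nrm A y" for n
      using nrm_mult[of "t n \<ominus> l" y] y by (simp add: diff_mult)
    have 3: "nrm A (t n \<otimes> y \<ominus> y \<otimes> l) \<le> nrm A (t n \<ominus> l) * nrm A y" for n
      using nrm_mult[of y "t n \<ominus> l"] y by (simp add: mult_diff t_comm mult.commute)
    show "(\<lambda>n. nrm A (t n \<otimes> y \<ominus> l \<otimes> y)) \<longlonglongrightarrow> 0"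
      by (rule tendsto_sandwich[OF _ _ tendsto_const]) (use 1 2 y nrm_nonneg in auto)
    show "(\<lambda>n. nrm A (t n \<otimes> y \<ominus> y \<otimes> l)) \<longlonglongrightarrow> 0"
      by (rule tendsto_sandwich[OF _ _ tendsto_const]) (use 1 3 y nrm_nonneg in auto)
  qed (use y in auto)
  \<comment> \<open>The map sending x to \<open>(1 / 2) \<odot> (w \<oplus> x \<otimes> x)\<close>
    does not increase the distance between \<open>t n\<close> and \<open>l\<close>, both in the unit
    ball. Hence the shifted sequence converges to \<open>l\<close> and to the image of
    \<open>l\<close>.\<close>
  have l_fix: "l = (1 / 2) \<odot> (w \<oplus> l \<otimes> l)"
  proof (rule limit_unique[of "\<lambda>n. t (Suc n)"])
    show "(\<lambda>n. nrm A (t (Suc n) \<ominus> l)) \<longlonglongrightarrow> 0"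
      using LIMSEQ_Suc[OF lim] .
    have "nrm A (t (Suc n) \<ominus> (1 / 2) \<odot> (w \<oplus> l \<otimes> l)) \<le> nrm A (t n \<ominus> l)" for n
    proof -
      have "(w \<oplus> a) \<ominus> (w \<oplus> b) = a \<ominus> b" if "a \<in> carrier A" "b \<in> carrier A" for a b
        using that w(1) by algebra
      then have "t (Suc n) \<ominus> (1 / 2) \<odot> (w \<oplus> l \<otimes> l) = (1 / 2) \<odot> (t n \<otimes> t n \<ominus> l \<otimes> l)"
        using smult_diff[of "w \<oplus> t n \<otimes> t n" "w \<oplus> l \<otimes> l" "1 / 2"] w by (simp add: t_simps)
      then have "2 * nrm A (t (Suc n) \<ominus> (1 / 2) \<odot> (w \<oplus> l \<otimes> l)) = nrm A (t n \<otimes> t n \<ominus> l \<otimes> l)"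
        by (simp add: nrm_smult)
      also have "\<dots> \<le> nrm A (t n) * nrm A (t n \<ominus> l) + nrm A (t n \<ominus> l) * nrm A l"
        by (intro nrm_diff_mult) auto
      also have "\<dots> \<le> 1 * nrm A (t n \<ominus> l) + nrm A (t n \<ominus> l) * 1"
        using le_1[of n] l_nrm nrm_nonneg by (intro add_mono mult_mono) auto
      finally show ?thesis by simp
    qed
    then show "(\<lambda>n. nrm A (t (Suc n) \<ominus> (1 / 2) \<odot> (w \<oplus> l \<otimes> l))) \<longlonglongrightarrow> 0"
      by (intro tendsto_sandwich[OF _ _ tendsto_const lim]) (use w nrm_nonneg in auto)
  qed (use w in auto)
  show ?thesis
  proof
    show "\<one> \<ominus> l \<in> carrier A" by simp
    show "star A (\<one> \<ominus> l) = \<one> \<ominus> l"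
      by (simp add: star_diff l_star)
    have "2 \<odot> l = w \<oplus> l \<otimes> l"
      using w by (subst l_fix) simp
    then have ll: "l \<oplus> l = w \<oplus> l \<otimes> l"
      using smult_add_left[of l 1 1] by simp
    have "(\<one> \<ominus> l) \<otimes> (\<one> \<ominus> l) = \<one> \<oplus> l \<otimes> l \<ominus> (l \<oplus> l)"
      using l by (simp add: ring_simprules)
    also have "\<dots> = \<one> \<ominus> w"
      unfolding ll using l w(1) by algebra
    finally show "(\<one> \<ominus> l) \<otimes> (\<one> \<ominus> l) = \<one> \<ominus> w" .
    have "\<one> \<ominus> (\<one> \<ominus> l) = l"
      using l by algebra
    then show "nrm A (\<one> \<ominus> (\<one> \<ominus> l)) \<le> 1"
      using l_nrm by simp
    show "(\<one> \<ominus> l) \<otimes> y = y \<otimes> (\<one> \<ominus> l)" if "y \<in> carrier A" "w \<otimes> y = y \<otimes> w" for y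
      using that l_comm[OF that] by (simp add: diff_mult mult_diff)
  qed
qed

text \<open>The root \<open>s\<close> of \<open>\<one> \<ominus> h \<otimes> h\<close> commutes with
  \<open>h\<close>, and the squares of \<open>s\<close> and \<open>h\<close> add up to the unit. So
  the norm of s^2 is at most that of the unit. This stands in for the spectral bound 0 \<le> 1 - h^2
  \<le> 1.\<close>

lemma nrm_one_diff_square_le:
  assumes h: "h \<in> carrier A" "star A h = h" "nrm A h \<le> 1"
  shows "nrm A (\<one> \<ominus> h \<otimes> h) \<le> 1"
proof -
  have hh: "h \<otimes> h \<in> carrier A" "star A (h \<otimes> h) = h \<otimes> h" "nrm A (h \<otimes> h) \<le> 1"
    using h nrm_nonneg[of h] by (simp_all add: nrm_selfadjoint_square power_le_one star_mult)
  obtain s where s: "s \<in> carrier A" "star A s = s" "s \<otimes> s = \<one> \<ominus> h \<otimes> h"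
      "\<And>y. y \<in> carrier A \<Longrightarrow> h \<otimes> h \<otimes> y = y \<otimes> (h \<otimes> h) \<Longrightarrow> s \<otimes> y = y \<otimes> s"
    using sqrt_exists[OF hh] by blast
  have "s \<otimes> h = h \<otimes> s"
    using s(4)[of h] h by (simp add: m_assoc)
  then have "(nrm A s)\<^sup>2 \<le> nrm A (s \<otimes> s \<oplus> h \<otimes> h)"
    using nrm_square_le_nrm_sum_squares[of s h] s(1,2) h by simp
  also have "s \<otimes> s \<oplus> h \<otimes> h = \<one>"
    unfolding s(3) using h(1) by algebra
  finally show ?thesis
    using nrm_one s(1-3) nrm_selfadjoint_square[of s] by simp
qed

text \<open>A form of uniqueness of positive square roots, with positivity expressed by being a
  square. For d = e^2 - g^2, commutativity gives (e d)^2 + (g d)^2 = d (e^4 - g^4) = 0. Both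
  summands are squares of self-adjoint elements, so e d = g d = 0, hence d^2 = e (e d) - g (g d) = 0
  and d = 0.\<close>

lemma fourth_powers_eq_imp_squares_eq:
  assumes e: "e \<in> carrier A" "star A e = e" and g: "g \<in> carrier A" "star A g = g"
    and comm: "e \<otimes> g = g \<otimes> e"
    and eq: "(e \<otimes> e) \<otimes> (e \<otimes> e) = (g \<otimes> g) \<otimes> (g \<otimes> g)"
  shows "e \<otimes> e = g \<otimes> g"
proof -
  define d where "d = e \<otimes> e \<ominus> g \<otimes> g"
  have d [simp]: "d \<in> carrier A" and d_star: "star A d = d"
    using e g by (simp_all add: d_def star_diff star_mult)
  have lcomm: "e \<otimes> (g \<otimes> x) = g \<otimes> (e \<otimes> x)" if "x \<in> carrier A" for x
    using that e g comm by (simp add: m_assoc[symmetric])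
  have ed: "e \<otimes> d = d \<otimes> e" and gd: "g \<otimes> d = d \<otimes> g"
    using e g comm lcomm by (simp_all add: d_def mult_diff diff_mult m_assoc)
  have edl: "e \<otimes> (d \<otimes> x) = d \<otimes> (e \<otimes> x)" and gdl: "g \<otimes> (d \<otimes> x) = d \<otimes> (g \<otimes> x)"
    if "x \<in> carrier A" for x
    using that e g ed gd by (simp_all add: m_assoc[symmetric])
  have egd: "(e \<otimes> d) \<otimes> (g \<otimes> d) = (g \<otimes> d) \<otimes> (e \<otimes> d)"
    using e g by (simp add: m_assoc comm lcomm ed edl gd gdl)
  have sums: "(e \<otimes> d) \<otimes> (e \<otimes> d) \<oplus> (g \<otimes> d) \<otimes> (g \<otimes> d) = \<zero>"
  proof -
    have "(e \<otimes> d) \<otimes> (e \<otimes> d) \<oplus> (g \<otimes> d) \<otimes> (g \<otimes> d) = d \<otimes> ((e \<otimes> e \<oplus> g \<otimes> g) \<otimes> d)"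
      using e g by (simp add: m_assoc r_distr l_distr ed edl gd gdl)
    also have "(e \<otimes> e \<oplus> g \<otimes> g) \<otimes> d = (e \<otimes> e) \<otimes> (e \<otimes> e) \<ominus> (g \<otimes> g) \<otimes> (g \<otimes> g)"
    proof -
      have "(x \<oplus> y) \<otimes> (x \<ominus> y) = x \<otimes> x \<ominus> y \<otimes> y"
        if "x \<in> carrier A" "y \<in> carrier A" "x \<otimes> y = y \<otimes> x" for x y
      proof -
        have "(x \<oplus> y) \<otimes> (x \<ominus> y) = x \<otimes> x \<ominus> y \<otimes> y \<ominus> x \<otimes> y \<oplus> y \<otimes> x"
          using that(1,2) by algebra
        also have "\<dots> = x \<otimes> x \<ominus> y \<otimes> y"
          unfolding that(3) using that(1,2) by algebra
        finally show ?thesis .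
      qed
      moreover have "(e \<otimes> e) \<otimes> (g \<otimes> g) = (g \<otimes> g) \<otimes> (e \<otimes> e)"
        using e g comm lcomm by (simp add: m_assoc)
      ultimately show ?thesis
        using e g by (simp add: d_def)
    qed
    also have "\<dots> = \<zero>"
      using e g by (simp add: eq)
    finally show ?thesis
      by simp
  qed
  have "nrm A (e \<otimes> d) = 0"
    using nrm_square_le_nrm_sum_squares[of "e \<otimes> d" "g \<otimes> d"] e g d_star ed gd egd sums
    by (simp add: star_mult)
  then have ed0: "e \<otimes> d = \<zero>"
    using e by (simp add: nrm_eq_0)
  have gd0: "g \<otimes> d = \<zero>"
    using nrm_square_le_nrm_sum_squares[of "g \<otimes> d" "e \<otimes> d"] e g d_star ed gd egd sums
    by (simp add: star_mult a_comm nrm_eq_0)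
  have "d \<otimes> d = e \<otimes> (e \<otimes> d) \<ominus> g \<otimes> (g \<otimes> d)"
    using e g by (subst d_def) (simp add: diff_mult m_assoc)
  then have "d \<otimes> d = \<zero>"
    using e g by (simp add: ed0 gd0)
  then have "nrm A d = 0"
    using nrm_selfadjoint_square[of d] d_star by simp
  then show ?thesis
    using e g by (simp add: nrm_eq_0 d_def)
qed

end

section \<open>Morphisms of C*-algebras\<close>

context cstar_algebra
begin

text \<open>Here \<open>e \<otimes> e\<close> is the absolute value of \<open>k\<close>.\<close>
lemma fourth_root_exists:
  assumes k: "k \<in> carrier A" "star A k = k" "nrm A k \<le> 1"
  obtains e where "e \<in> carrier A" "star A e = e" "(e \<otimes> e) \<otimes> (e \<otimes> e) = k \<otimes> k"
    "\<And>y. y \<in> carrier A \<Longrightarrow> k \<otimes> y = y \<otimes> k \<Longrightarrow> e \<otimes> y = y \<otimes> e"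
proof -
  have diff_diff: "\<one> \<ominus> (\<one> \<ominus> x) = x" if "x \<in> carrier A" for x
    using that by algebra
  have w: "\<one> \<ominus> k \<otimes> k \<in> carrier A" "star A (\<one> \<ominus> k \<otimes> k) = \<one> \<ominus> k \<otimes> k"
      "nrm A (\<one> \<ominus> k \<otimes> k) \<le> 1"
    using k by (simp_all add: star_diff star_mult nrm_one_diff_square_le)
  \<comment> \<open>\<open>b\<close> is a square root of k^2. The bound on
    \<open>\<one> \<ominus> b\<close> is exactly what allows a second root to be taken, now of
    \<open>b\<close> itself.\<close>
  obtain b where b: "b \<in> carrier A" "star A b = b" "b \<otimes> b = \<one> \<ominus> (\<one> \<ominus> k \<otimes> k)" "nrm A (\<one> \<ominus> b) \<le> 1"
    and b_comm: "\<And>y. y \<in> carrier A \<Longrightarrow> (\<one> \<ominus> k \<otimes> k) \<otimes> y = y \<otimes> (\<one> \<ominus> k \<otimes> k) \<Longrightarrow> b \<otimes> y = y \<otimes> b"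
    using sqrt_exists[OF w] by blast
  have w': "\<one> \<ominus> b \<in> carrier A" "star A (\<one> \<ominus> b) = \<one> \<ominus> b"
    using b by (simp_all add: star_diff)
  obtain e where e: "e \<in> carrier A" "star A e = e" "e \<otimes> e = \<one> \<ominus> (\<one> \<ominus> b)"
    and e_comm: "\<And>y. y \<in> carrier A \<Longrightarrow> (\<one> \<ominus> b) \<otimes> y = y \<otimes> (\<one> \<ominus> b) \<Longrightarrow> e \<otimes> y = y \<otimes> e"
    using sqrt_exists[OF w' b(4)] by blast
  show ?thesis
  proof (rule that[OF e(1,2)])
    show "(e \<otimes> e) \<otimes> (e \<otimes> e) = k \<otimes> k"
      using e(3) b(1,3) k(1) by (simp add: diff_diff)
  next
    fix y assume y: "y \<in> carrier A" "k \<otimes> y = y \<otimes> k"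
    \<comment> \<open>Commutation with \<open>y\<close> is passed from \<open>k\<close> to its
      square, then to \<open>b\<close>, then to \<open>e\<close>.\<close>
    have "k \<otimes> k \<otimes> y = y \<otimes> (k \<otimes> k)"
      using y k m_assoc[of k k y] m_assoc[of k y k] m_assoc[of y k k] by simp
    then have "b \<otimes> y = y \<otimes> b"
      using y k by (intro b_comm) (simp_all add: diff_mult mult_diff)
    then show "e \<otimes> y = y \<otimes> e"
      using y b by (intro e_comm) (simp_all add: diff_mult mult_diff)
  qed
qed

end

section \<open>Contractivity, and isometry in the injective case\<close>

locale cstar_hom = A: cstar_algebra A + B: cstar_algebra B
  for A :: "('a, 'm) cstar_scheme" and B :: "('b, 'n) cstar_scheme" +
  fixes \<pi> :: "'a \<Rightarrow> 'b"
  assumes hom: "\<pi> \<in> star_hom A B"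
begin

lemma hom_closed [simp]: "x \<in> carrier A \<Longrightarrow> \<pi> x \<in> carrier B"
  and hom_mult: "x \<in> carrier A \<Longrightarrow> y \<in> carrier A \<Longrightarrow> \<pi> (x \<otimes>\<^bsub>A\<^esub> y) = \<pi> x \<otimes>\<^bsub>B\<^esub> \<pi> y"
  and hom_add: "x \<in> carrier A \<Longrightarrow> y \<in> carrier A \<Longrightarrow> \<pi> (x \<oplus>\<^bsub>A\<^esub> y) = \<pi> x \<oplus>\<^bsub>B\<^esub> \<pi> y"
  and hom_one [simp]: "\<pi> \<one>\<^bsub>A\<^esub> = \<one>\<^bsub>B\<^esub>"
  and hom_smult: "x \<in> carrier A \<Longrightarrow> \<pi> (c \<odot>\<^bsub>A\<^esub> x) = c \<odot>\<^bsub>B\<^esub> \<pi> x"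
  and hom_star: "x \<in> carrier A \<Longrightarrow> \<pi> (star A x) = star B (\<pi> x)"
  using hom by (auto simp: star_hom_def ring_hom_def)

lemma hom_zero [simp]: "\<pi> \<zero>\<^bsub>A\<^esub> = \<zero>\<^bsub>B\<^esub>"
  using hom_smult[of "\<one>\<^bsub>A\<^esub>" 0] by simp

lemma hom_minus: "x \<in> carrier A \<Longrightarrow> \<pi> (\<ominus>\<^bsub>A\<^esub> x) = \<ominus>\<^bsub>B\<^esub> \<pi> x"
  by (simp add: A.minus_eq_smult B.minus_eq_smult hom_smult)

lemma hom_diff:
  "x \<in> carrier A \<Longrightarrow> y \<in> carrier A \<Longrightarrow> \<pi> (x \<ominus>\<^bsub>A\<^esub> y) = \<pi> x \<ominus>\<^bsub>B\<^esub> \<pi> y"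
  by (simp add: a_minus_def hom_add hom_minus)

text \<open>For \<open>y\<close> in the unit ball put h = y* y and let s^2 = 1 - h^2 with
  \<open>s\<close> commuting with \<open>h\<close>. The identity h^2 + s^2 = 1 survives under
  \<open>\<pi>\<close> and forces the norm of \<open>\<pi> h\<close>, which is the square of that of
  \<open>\<pi> y\<close>, to be at most 1. Scaling gives the general case.\<close>

lemma nrm_hom_le:
  assumes x: "x \<in> carrier A"
  shows "nrm B (\<pi> x) \<le> nrm A x"
proof -
  have le_1: "nrm B (\<pi> y) \<le> 1" if y: "y \<in> carrier A" and y1: "nrm A y \<le> 1" for y
  proof -
    define h where "h = star A y \<otimes>\<^bsub>A\<^esub> y"
    have h: "h \<in> carrier A" "star A h = h" "nrm A h \<le> 1"
      using y y1 A.nrm_nonneg[OF y]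
      by (simp_all add: h_def A.star_mult A.cstar_identity power_le_one)
    have hh: "h \<otimes>\<^bsub>A\<^esub> h \<in> carrier A" "star A (h \<otimes>\<^bsub>A\<^esub> h) = h \<otimes>\<^bsub>A\<^esub> h" "nrm A (h \<otimes>\<^bsub>A\<^esub> h) \<le> 1"
      using h A.nrm_nonneg[of h] by (simp_all add: A.nrm_selfadjoint_square power_le_one A.star_mult)
    obtain s where s: "s \<in> carrier A" "star A s = s" "s \<otimes>\<^bsub>A\<^esub> s = \<one>\<^bsub>A\<^esub> \<ominus>\<^bsub>A\<^esub> h \<otimes>\<^bsub>A\<^esub> h"
      and s_comm: "\<And>y. y \<in> carrier A \<Longrightarrow> h \<otimes>\<^bsub>A\<^esub> h \<otimes>\<^bsub>A\<^esub> y = y \<otimes>\<^bsub>A\<^esub> (h \<otimes>\<^bsub>A\<^esub> h) \<Longrightarrow> s \<otimes>\<^bsub>A\<^esub> y = y \<otimes>\<^bsub>A\<^esub> s"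
      using A.sqrt_exists[OF hh] by blast
    have "s \<otimes>\<^bsub>A\<^esub> h = h \<otimes>\<^bsub>A\<^esub> s"
      using s_comm[of h] h by (simp add: A.m_assoc)
    then have comm: "\<pi> h \<otimes>\<^bsub>B\<^esub> \<pi> s = \<pi> s \<otimes>\<^bsub>B\<^esub> \<pi> h"
      using h s by (simp flip: hom_mult)
    have "h \<otimes>\<^bsub>A\<^esub> h \<oplus>\<^bsub>A\<^esub> s \<otimes>\<^bsub>A\<^esub> s = \<one>\<^bsub>A\<^esub>"
      unfolding s(3) using h(1) by algebra
    then have sum: "\<pi> h \<otimes>\<^bsub>B\<^esub> \<pi> h \<oplus>\<^bsub>B\<^esub> \<pi> s \<otimes>\<^bsub>B\<^esub> \<pi> s = \<one>\<^bsub>B\<^esub>"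
      using h s(1) by (simp flip: hom_mult hom_add)
    have "(nrm B (\<pi> h))\<^sup>2 \<le> 1"
      using B.nrm_square_le_nrm_sum_squares[of "\<pi> h" "\<pi> s"] comm sum h s(1,2) B.nrm_one
      by (simp flip: hom_star)
    moreover have "nrm B (\<pi> h) = (nrm B (\<pi> y))\<^sup>2"
      using y by (simp add: h_def hom_mult hom_star B.cstar_identity)
    ultimately have "(nrm B (\<pi> y)) ^ 4 \<le> 1"
      by (simp flip: power_mult)
    then show ?thesis
      using power_le_one_iff[of "nrm B (\<pi> y)" 4] B.nrm_nonneg[of "\<pi> y"] y by simp
  qed
  show ?thesis
  proof (cases "nrm A x = 0")
    case True
    then show ?thesis using x by (simp add: A.nrm_eq_0)
  next
    case False
    define c where "c = nrm A x"
    have c: "0 < c"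
      using False A.nrm_nonneg[OF x] by (simp add: c_def)
    have "nrm B (\<pi> (complex_of_real (1 / c) \<odot>\<^bsub>A\<^esub> x)) \<le> 1"
      by (rule le_1) (use x c in \<open>simp_all add: A.nrm_smult norm_divide flip: c_def\<close>)
    then have "nrm B (\<pi> x) \<le> c"
      using x c by (simp add: hom_smult B.nrm_smult norm_divide field_simps)
    then show ?thesis
      by (simp add: c_def)
  qed
qed

text \<open>
  Suppose \<open>\<parallel>\<pi> h\<parallel>\<^sup>2 \<le> r < 1\<close> with \<open>\<parallel>h\<parallel> \<le> 1\<close> and \<open>k = h\<^sup>2 - r\<close>.  Then \<open>\<pi> k\<close> is negative, so
  \<open>\<pi> \<bar>k\<bar> = - \<pi> k\<close>; by injectivity \<open>-k = \<bar>k\<bar>\<close> is a square \<open>e\<^sup>2\<close>, and \<open>h\<^sup>2 + e\<^sup>2 = r\<close> bounds \<open>h\<close>.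
\<close>
lemma nrm_le_of_nrm_hom_le:
  assumes inj: "inj_on \<pi> (carrier A)"
    and h: "h \<in> carrier A" "star A h = h" "nrm A h \<le> 1"
    and r: "(nrm B (\<pi> h))\<^sup>2 \<le> r" "0 < r" "r < 1"
  shows "(nrm A h)\<^sup>2 \<le> r"
proof -
  define R where "R = complex_of_real r \<odot>\<^bsub>A\<^esub> \<one>\<^bsub>A\<^esub>"
  have R: "R \<in> carrier A" "star A R = R" and hom_R: "\<pi> R = complex_of_real r \<odot>\<^bsub>B\<^esub> \<one>\<^bsub>B\<^esub>"
    by (simp_all add: R_def A.star_smult hom_smult)
  have R_comm: "R \<otimes>\<^bsub>A\<^esub> x = x \<otimes>\<^bsub>A\<^esub> R" if "x \<in> carrier A" for x
    using that by (simp add: R_def A.smult_mult_left A.smult_mult_right)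
  define p where "p = h \<otimes>\<^bsub>A\<^esub> h"
  have p: "p \<in> carrier A" "star A p = p" "nrm A p \<le> 1"
    using h A.nrm_nonneg[of h]
    by (simp_all add: p_def A.star_mult A.nrm_selfadjoint_square power_le_one)
  define k where "k = p \<ominus>\<^bsub>A\<^esub> R"
  have k: "k \<in> carrier A" "star A k = k"
    using p R by (simp_all add: k_def A.star_diff)
  \<comment> \<open>Writing k = (1 - r) p - r (1 - p), with \<open>p\<close> and 1 - p in the unit
    ball, gives the bound 1 needed for the fourth root; the triangle inequality on p - r would only
    give 1 + r.\<close>
  have k_eq: "k = complex_of_real (1 - r) \<odot>\<^bsub>A\<^esub> p \<ominus>\<^bsub>A\<^esub> complex_of_real r \<odot>\<^bsub>A\<^esub> (\<one>\<^bsub>A\<^esub> \<ominus>\<^bsub>A\<^esub> p)"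
  proof -
    have split: "p = complex_of_real (1 - r) \<odot>\<^bsub>A\<^esub> p \<oplus>\<^bsub>A\<^esub> complex_of_real r \<odot>\<^bsub>A\<^esub> p"
      using p(1) by (simp flip: A.smult_add_left)
    have assoc: "x \<oplus>\<^bsub>A\<^esub> y \<ominus>\<^bsub>A\<^esub> z = x \<ominus>\<^bsub>A\<^esub> (z \<ominus>\<^bsub>A\<^esub> y)"
      if "x \<in> carrier A" "y \<in> carrier A" "z \<in> carrier A" for x y z
      using that by algebra
    show ?thesis
      unfolding k_def using arg_cong[where f = "\<lambda>x. x \<ominus>\<^bsub>A\<^esub> R", OF split] p(1)
      by (simp add: assoc R_def A.smult_diff)
  qed
  have "nrm A k \<le> (1 - r) * nrm A p + r * nrm A (\<one>\<^bsub>A\<^esub> \<ominus>\<^bsub>A\<^esub> p)"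
    unfolding k_eq
    using A.nrm_diff[of "complex_of_real (1 - r) \<odot>\<^bsub>A\<^esub> p" "complex_of_real r \<odot>\<^bsub>A\<^esub> (\<one>\<^bsub>A\<^esub> \<ominus>\<^bsub>A\<^esub> p)"] p(1) r
    by (simp add: A.nrm_smult del: of_real_diff)
  also have "\<dots> \<le> (1 - r) * 1 + r * 1"
    using r p(3) A.nrm_one_diff_square_le[OF h] by (intro add_mono mult_left_mono) (auto simp: p_def)
  finally have k_nrm: "nrm A k \<le> 1"
    by simp
  obtain e where e: "e \<in> carrier A" "star A e = e"
      "(e \<otimes>\<^bsub>A\<^esub> e) \<otimes>\<^bsub>A\<^esub> (e \<otimes>\<^bsub>A\<^esub> e) = k \<otimes>\<^bsub>A\<^esub> k"
    and e_comm: "\<And>y. y \<in> carrier A \<Longrightarrow> k \<otimes>\<^bsub>A\<^esub> y = y \<otimes>\<^bsub>A\<^esub> k \<Longrightarrow> e \<otimes>\<^bsub>A\<^esub> y = y \<otimes>\<^bsub>A\<^esub> e"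
    using A.fourth_root_exists[OF k k_nrm] by blast
  have eh: "e \<otimes>\<^bsub>A\<^esub> h = h \<otimes>\<^bsub>A\<^esub> e"
    using h(1) R(1) R_comm[of h]
    by (intro e_comm) (simp_all add: k_def p_def A.diff_mult A.mult_diff A.m_assoc)
  have ep: "e \<otimes>\<^bsub>A\<^esub> p = p \<otimes>\<^bsub>A\<^esub> e"
    using p(1) R(1) R_comm[of p] by (intro e_comm) (simp_all add: k_def A.diff_mult A.mult_diff)
  \<comment> \<open>The assumption on \<open>r\<close> puts \<open>?w\<close> in the unit ball. With
    f^2 = 1 - w, the element g = sqrt(r) f satisfies g^2 = r - \<pi> p, the negative of \<pi>
    k.\<close>
  let ?w = "complex_of_real (1 / r) \<odot>\<^bsub>B\<^esub> \<pi> p"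
  have "nrm B (\<pi> p) = (nrm B (\<pi> h))\<^sup>2"
    using h B.nrm_selfadjoint_square[of "\<pi> h"] by (simp add: p_def hom_mult flip: hom_star)
  then have w: "?w \<in> carrier B" "star B ?w = ?w" "nrm B ?w \<le> 1"
    using p r by (simp_all add: B.star_smult B.nrm_smult norm_divide divide_simps flip: hom_star)
  obtain f where f: "f \<in> carrier B" "star B f = f" "f \<otimes>\<^bsub>B\<^esub> f = \<one>\<^bsub>B\<^esub> \<ominus>\<^bsub>B\<^esub> ?w"
    and f_comm: "\<And>y. y \<in> carrier B \<Longrightarrow> ?w \<otimes>\<^bsub>B\<^esub> y = y \<otimes>\<^bsub>B\<^esub> ?w \<Longrightarrow> f \<otimes>\<^bsub>B\<^esub> y = y \<otimes>\<^bsub>B\<^esub> f"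
    using B.sqrt_exists[OF w] by blast
  define g where "g = complex_of_real (sqrt r) \<odot>\<^bsub>B\<^esub> f"
  have g: "g \<in> carrier B" "star B g = g"
    using f(1,2) by (simp_all add: g_def B.star_smult)
  have gg: "g \<otimes>\<^bsub>B\<^esub> g = \<ominus>\<^bsub>B\<^esub> \<pi> k"
  proof -
    have "g \<otimes>\<^bsub>B\<^esub> g = complex_of_real r \<odot>\<^bsub>B\<^esub> (f \<otimes>\<^bsub>B\<^esub> f)"
      using f(1) r by (simp add: g_def B.smult_mult_left B.smult_mult_right flip: of_real_mult)
    also have "\<dots> = \<pi> R \<ominus>\<^bsub>B\<^esub> \<pi> p"
      unfolding f(3) hom_R using p(1) r by (simp add: B.smult_diff)
    also have "\<dots> = \<ominus>\<^bsub>B\<^esub> (\<pi> p \<ominus>\<^bsub>B\<^esub> \<pi> R)"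
    proof -
      have "x \<ominus>\<^bsub>B\<^esub> y = \<ominus>\<^bsub>B\<^esub> (y \<ominus>\<^bsub>B\<^esub> x)" if "x \<in> carrier B" "y \<in> carrier B" for x y
        using that by algebra
      then show ?thesis using p(1) R(1) hom_closed by blast
    qed
    finally show ?thesis
      using p(1) R(1) by (simp add: k_def hom_diff)
  qed
  \<comment> \<open>\<open>?w\<close> is a multiple of \<open>\<pi> p\<close>, and \<open>e\<close>
    commutes with \<open>p\<close>; hence the root \<open>f\<close> commutes with
    \<open>\<pi> e\<close>.\<close>
  have "f \<otimes>\<^bsub>B\<^esub> \<pi> e = \<pi> e \<otimes>\<^bsub>B\<^esub> f"
    using e(1) p(1) ep
    by (intro f_comm) (simp_all add: B.smult_mult_left B.smult_mult_right flip: hom_mult)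
  then have eg: "\<pi> e \<otimes>\<^bsub>B\<^esub> g = g \<otimes>\<^bsub>B\<^esub> \<pi> e"
    using e(1) f(1) by (simp add: g_def B.smult_mult_left B.smult_mult_right)
  have "(\<pi> e \<otimes>\<^bsub>B\<^esub> \<pi> e) \<otimes>\<^bsub>B\<^esub> (\<pi> e \<otimes>\<^bsub>B\<^esub> \<pi> e) = \<pi> (k \<otimes>\<^bsub>A\<^esub> k)"
    unfolding e(3)[symmetric] using e(1) by (simp add: hom_mult)
  also have "\<dots> = (g \<otimes>\<^bsub>B\<^esub> g) \<otimes>\<^bsub>B\<^esub> (g \<otimes>\<^bsub>B\<^esub> g)"
    unfolding gg using k(1) by (simp add: hom_mult B.l_minus B.r_minus)
  finally have powers_eq:
    "(\<pi> e \<otimes>\<^bsub>B\<^esub> \<pi> e) \<otimes>\<^bsub>B\<^esub> (\<pi> e \<otimes>\<^bsub>B\<^esub> \<pi> e) = (g \<otimes>\<^bsub>B\<^esub> g) \<otimes>\<^bsub>B\<^esub> (g \<otimes>\<^bsub>B\<^esub> g)" .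
  \<comment> \<open>Both sides have the square of \<open>\<pi> k\<close> as their square. Once they
    agree, injectivity pulls the equality back to \<open>A\<close>.\<close>
  have "\<pi> e \<otimes>\<^bsub>B\<^esub> \<pi> e = g \<otimes>\<^bsub>B\<^esub> g"
    by (rule B.fourth_powers_eq_imp_squares_eq[OF _ _ g eg powers_eq]) (use e(1,2) in \<open>simp_all flip: hom_star\<close>)
  then have "\<pi> (e \<otimes>\<^bsub>A\<^esub> e) = \<pi> (\<ominus>\<^bsub>A\<^esub> k)"
    using e(1) k(1) gg by (simp add: hom_mult hom_minus)
  then have ee: "e \<otimes>\<^bsub>A\<^esub> e = \<ominus>\<^bsub>A\<^esub> k"
    using inj e(1) k(1) by (auto dest: inj_onD)
  have "h \<otimes>\<^bsub>A\<^esub> h \<oplus>\<^bsub>A\<^esub> e \<otimes>\<^bsub>A\<^esub> e = R"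
    unfolding ee k_def p_def using h(1) R(1) by algebra
  then have "(nrm A h)\<^sup>2 \<le> nrm A R"
    using A.nrm_square_le_nrm_sum_squares[OF h(1,2) e(1,2)] eh by simp
  also have "\<dots> \<le> r"
    using r A.nrm_one by (simp add: R_def A.nrm_smult mult_left_le)
  finally show ?thesis .
qed

text \<open>If the norm dropped at \<open>x\<close>, rescaling to \<open>y\<close> of norm 1 and
  passing to h = y* y would give \<open>h\<close> of norm 1 with an image of norm below 1. The
  preceding lemma then bounds the norm of \<open>h\<close> below 1 as well.\<close>

lemma nrm_hom_eq:
  assumes inj: "inj_on \<pi> (carrier A)" and x: "x \<in> carrier A"
  shows "nrm B (\<pi> x) = nrm A x"
proof (rule antisym[OF nrm_hom_le[OF x]], rule ccontr)
  assume "\<not> nrm A x \<le> nrm B (\<pi> x)"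
  then have less: "nrm B (\<pi> x) < nrm A x"
    by simp
  define c where "c = nrm A x"
  have c: "0 < c"
    using less B.nrm_nonneg[of "\<pi> x"] x by (simp add: c_def)
  define y where "y = complex_of_real (1 / c) \<odot>\<^bsub>A\<^esub> x"
  have y: "y \<in> carrier A" "nrm A y = 1" "nrm B (\<pi> y) < 1"
    using x c less
    by (simp_all add: y_def hom_smult A.nrm_smult B.nrm_smult norm_divide flip: c_def)
  define h where "h = star A y \<otimes>\<^bsub>A\<^esub> y"
  have h: "h \<in> carrier A" "star A h = h" "nrm A h = 1"
    using y(1,2) by (simp_all add: h_def A.star_mult A.cstar_identity)
  have "nrm B (\<pi> h) = (nrm B (\<pi> y))\<^sup>2"
    using y(1) by (simp add: h_def hom_mult hom_star B.cstar_identity)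
  then have "(nrm B (\<pi> h))\<^sup>2 = (nrm B (\<pi> y)) ^ 4"
    by (simp flip: power_mult)
  moreover have "(nrm B (\<pi> y)) ^ 4 < 1"
    using y B.nrm_nonneg[of "\<pi> y"] by (simp add: power_less_one_iff)
  \<comment> \<open>This maximum serves as \<open>r\<close>; the entry 1/2 keeps it positive when
    \<open>\<pi> h\<close> vanishes.\<close>
  ultimately have "max ((nrm B (\<pi> h))\<^sup>2) (1 / 2) < 1"
    by simp
  then have "(nrm A h)\<^sup>2 \<le> max ((nrm B (\<pi> h))\<^sup>2) (1 / 2)"
    using h by (intro nrm_le_of_nrm_hom_le[OF inj]) auto
  with \<open>max ((nrm B (\<pi> h))\<^sup>2) (1 / 2) < 1\<close> show False
    using h(3) by simp
qed

end

section \<open>Two by two matrices\<close>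

lemma mat2_eq_iff [simp]: "mat2 a b c d = mat2 a' b' c' d' \<longleftrightarrow> a = a' \<and> b = b' \<and> c = c' \<and> d = d'"
  by (simp add: mat2_def vec_eq_iff forall_2)

context star_algebra
begin

lemma mat2_closed [simp]:
  "mat2 a b c d \<in> carrier (mat2_alg A) \<longleftrightarrow>
    a \<in> carrier A \<and> b \<in> carrier A \<and> c \<in> carrier A \<and> d \<in> carrier A"
  by (auto simp: mat2_alg_def mat2_def forall_2)

lemma mat2_add [simp]:
  "mat2 a b c d \<oplus>\<^bsub>mat2_alg A\<^esub> mat2 a' b' c' d' = mat2 (a \<oplus> a') (b \<oplus> b') (c \<oplus> c') (d \<oplus> d')"
  by (simp add: mat2_alg_def mat2_def vec_eq_iff)

lemma mat2_mult [simp]: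
  assumes "a \<in> carrier A" "b \<in> carrier A" "c \<in> carrier A" "d \<in> carrier A"
    "a' \<in> carrier A" "b' \<in> carrier A" "c' \<in> carrier A" "d' \<in> carrier A"
  shows "mat2 a b c d \<otimes>\<^bsub>mat2_alg A\<^esub> mat2 a' b' c' d' =
    mat2 (a \<otimes> a' \<oplus> b \<otimes> c') (a \<otimes> b' \<oplus> b \<otimes> d') (c \<otimes> a' \<oplus> d \<otimes> c') (c \<otimes> b' \<oplus> d \<otimes> d')"
  using assms by (simp add: mat2_alg_def mat2_def vec_eq_iff forall_2 UNIV_2 Pi_def)

lemma mat2_smult [simp]:
  "c \<odot>\<^bsub>mat2_alg A\<^esub> mat2 w x y z = mat2 (c \<odot> w) (c \<odot> x) (c \<odot> y) (c \<odot> z)"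
  by (simp add: mat2_alg_def mat2_def vec_eq_iff)

lemma mat2_star [simp]:
  "star (mat2_alg A) (mat2 a b c d) = mat2 (star A a) (star A c) (star A b) (star A d)"
  by (simp add: mat2_alg_def mat2_def vec_eq_iff forall_2)

lemma mat2_one: "\<one>\<^bsub>mat2_alg A\<^esub> = mat2 \<one> \<zero> \<zero> \<one>"
  by (simp add: mat2_alg_def mat2_def vec_eq_iff forall_2)

lemma mat2_zero: "\<zero>\<^bsub>mat2_alg A\<^esub> = mat2 \<zero> \<zero> \<zero> \<zero>"
  by (simp add: mat2_alg_def mat2_def vec_eq_iff)

lemma mat2_cases:
  assumes "P \<in> carrier (mat2_alg A)"
  obtains a b c d where "P = mat2 a b c d"
    "a \<in> carrier A" "b \<in> carrier A" "c \<in> carrier A" "d \<in> carrier A"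
proof
  show "P = mat2 (P $ 1 $ 1) (P $ 1 $ 2) (P $ 2 $ 1) (P $ 2 $ 2)"
    by (simp add: mat2_def vec_eq_iff forall_2)
qed (use assms in \<open>simp_all add: mat2_alg_def\<close>)

text \<open>Provides uniqueness of additive inverses, which identifies the abstract negative in
  \<open>mat2_minus\<close>.\<close>

lemma mat2_add_group: "group (add_monoid (mat2_alg A))"
proof (rule groupI)
  fix P assume "P \<in> carrier (add_monoid (mat2_alg A))"
  then obtain a b c d where P: "P = mat2 a b c d"
      "a \<in> carrier A" "b \<in> carrier A" "c \<in> carrier A" "d \<in> carrier A"
    by (auto elim: mat2_cases)
  show "\<exists>Q\<in>carrier (add_monoid (mat2_alg A)). Q \<otimes>\<^bsub>add_monoid (mat2_alg A)\<^esub> P =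
      \<one>\<^bsub>add_monoid (mat2_alg A)\<^esub>"
    by (rule bexI[of _ "mat2 (\<ominus> a) (\<ominus> b) (\<ominus> c) (\<ominus> d)"])
      (use P in \<open>simp_all add: mat2_zero l_neg\<close>)
qed (auto elim!: mat2_cases simp: mat2_zero a_assoc)

lemma mat2_minus:
  assumes "a \<in> carrier A" "b \<in> carrier A" "c \<in> carrier A" "d \<in> carrier A"
  shows "\<ominus>\<^bsub>mat2_alg A\<^esub> mat2 a b c d = mat2 (\<ominus> a) (\<ominus> b) (\<ominus> c) (\<ominus> d)"
  unfolding a_inv_def[of "mat2_alg A"]
  using group.inv_equality[OF mat2_add_group, of "mat2 (\<ominus> a) (\<ominus> b) (\<ominus> c) (\<ominus> d)" "mat2 a b c d"] assms
  by (simp add: mat2_zero l_neg)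

end

section \<open>The crossed product by an order-two automorphism\<close>

locale Z2_crossed_product = cstar_algebra A
  for A :: "'a cstar" (structure) and \<sigma> :: "'a \<Rightarrow> 'a"
    and C :: "'c cstar" and \<iota> :: "'a \<Rightarrow> 'c" and W :: 'c +
  assumes order_two: "order_two_star_automorphism A \<sigma>"
    and crossed_product: "crossed_product_Z2 A \<sigma> C \<iota> W"

sublocale Z2_crossed_product \<subseteq> \<sigma>: cstar_hom A A \<sigma>
  using order_two
  by unfold_locales (simp add: order_two_star_automorphism_def star_iso_def)

sublocale Z2_crossed_product \<subseteq> C: cstar_algebra C
  using crossed_product by (simp add: crossed_product_Z2_def)

sublocale Z2_crossed_product \<subseteq> \<iota>: cstar_hom A C \<iota>
  using crossed_product
  by unfold_locales (simp add: crossed_product_Z2_def covariant_pair_def)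

context Z2_crossed_product
begin

lemma \<sigma>_\<sigma> [simp]: "a \<in> carrier A \<Longrightarrow> \<sigma> (\<sigma> a) = a"
  using order_two by (simp add: order_two_star_automorphism_def)

lemma nrm_\<iota>: "a \<in> carrier A \<Longrightarrow> nrm C (\<iota> a) = nrm A a"
  using crossed_product by (intro \<iota>.nrm_hom_eq) (simp add: crossed_product_Z2_def)

lemma W_closed [simp]: "W \<in> carrier C" and W_W [simp]: "W \<otimes>\<^bsub>C\<^esub> W = \<one>\<^bsub>C\<^esub>"
  using crossed_product by (simp_all add: crossed_product_Z2_def covariant_pair_def unitary_def)

lemma star_W [simp]: "star C W = W"
proof -
  have "star C W = (star C W \<otimes>\<^bsub>C\<^esub> W) \<otimes>\<^bsub>C\<^esub> W"
    by (simp add: C.m_assoc)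
  also have "star C W \<otimes>\<^bsub>C\<^esub> W = \<one>\<^bsub>C\<^esub>"
    using crossed_product by (simp add: crossed_product_Z2_def covariant_pair_def unitary_def)
  finally show ?thesis
    by simp
qed

lemma W_\<iota>_W: "a \<in> carrier A \<Longrightarrow> W \<otimes>\<^bsub>C\<^esub> \<iota> a \<otimes>\<^bsub>C\<^esub> W = \<iota> (\<sigma> a)"
  using crossed_product by (simp add: crossed_product_Z2_def covariant_pair_def)

text \<open>The covariance relation multiplied by \<open>W\<close> on the right. Together with
  \<open>W_\<iota>_mult\<close> it moves every \<open>W\<close> to the right end of a
  product.\<close>

lemma W_\<iota>:
  assumes a: "a \<in> carrier A"
  shows "W \<otimes>\<^bsub>C\<^esub> \<iota> a = \<iota> (\<sigma> a) \<otimes>\<^bsub>C\<^esub> W"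
  unfolding W_\<iota>_W[OF a, symmetric] using a by (simp add: C.m_assoc)

lemma W_\<iota>_mult:
  assumes "a \<in> carrier A" "x \<in> carrier C"
  shows "W \<otimes>\<^bsub>C\<^esub> (\<iota> a \<otimes>\<^bsub>C\<^esub> x) = \<iota> (\<sigma> a) \<otimes>\<^bsub>C\<^esub> (W \<otimes>\<^bsub>C\<^esub> x)"
  using assms W_\<iota>[of a] by (simp add: C.m_assoc[symmetric])

lemma nrm_W: "nrm C W \<le> 1"
proof -
  have "(nrm C W)\<^sup>2 = nrm C \<one>\<^bsub>C\<^esub>"
    using C.cstar_identity[of W] by simp
  then show ?thesis
    using C.nrm_one power2_le_imp_le[of "nrm C W" 1] by simp
qed

text \<open>The dual automorphism comes from the covariant pair \<open>(\<iota>, -W)\<close>.\<close>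
lemma dual_automorphism_exists:
  obtains \<Phi> where "cstar_hom C C \<Phi>" "\<And>a. a \<in> carrier A \<Longrightarrow> \<Phi> (\<iota> a) = \<iota> a" "\<Phi> W = \<ominus>\<^bsub>C\<^esub> W"
proof -
  have "covariant_pair A \<sigma> C \<iota> (\<ominus>\<^bsub>C\<^esub> W)"
    unfolding covariant_pair_def unitary_def
    by (simp add: \<iota>.hom C.star_minus C.l_minus C.r_minus W_\<iota>_W)
  \<comment> \<open>The universal property is applied with \<open>C\<close> itself as the test
    algebra.\<close>
  then obtain \<Phi> where \<Phi>: "\<Phi> \<in> star_hom C C" "\<forall>a \<in> carrier A. \<Phi> (\<iota> a) = \<iota> a" "\<Phi> W = \<ominus>\<^bsub>C\<^esub> W"
    using crossed_product C.cstar_algebra_axioms unfolding crossed_product_Z2_def by blast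
  then have "cstar_hom C C \<Phi>"
    by unfold_locales
  with \<Phi> show ?thesis
    using that by blast
qed

section \<open>The normal form a + b W\<close>

definition element :: "'a \<Rightarrow> 'a \<Rightarrow> 'c" where
  "element a b = \<iota> a \<oplus>\<^bsub>C\<^esub> \<iota> b \<otimes>\<^bsub>C\<^esub> W"

lemma element_closed [simp]: "a \<in> carrier A \<Longrightarrow> b \<in> carrier A \<Longrightarrow> element a b \<in> carrier C"
  by (simp add: element_def)

lemma element_zero_right: "a \<in> carrier A \<Longrightarrow> element a \<zero> = \<iota> a"
  by (simp add: element_def)

lemma element_zero_one: "element \<zero> \<one> = W"
  by (simp add: element_def)

lemma element_one: "element \<one> \<zero> = \<one>\<^bsub>C\<^esub>"
  by (simp add: element_def)

lemma element_smult:
  "a \<in> carrier A \<Longrightarrow> b \<in> carrier A \<Longrightarrow> c \<odot>\<^bsub>C\<^esub> element a b = element (c \<odot> a) (c \<odot> b)"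
  by (simp add: element_def C.smult_add_right \<iota>.hom_smult C.smult_mult_left)

lemma element_star:
  "a \<in> carrier A \<Longrightarrow> b \<in> carrier A \<Longrightarrow> star C (element a b) = element (star A a) (\<sigma> (star A b))"
  by (simp add: element_def C.star_add C.star_mult W_\<iota> flip: \<iota>.hom_star)

context
  fixes a b a' b'
  assumes ab [simp]: "a \<in> carrier A" "b \<in> carrier A" "a' \<in> carrier A" "b' \<in> carrier A"
begin

lemma element_add: "element a b \<oplus>\<^bsub>C\<^esub> element a' b' = element (a \<oplus> a') (b \<oplus> b')"
  by (simp add: element_def \<iota>.hom_add C.l_distr C.a_ac)

lemma element_diff: "element a b \<ominus>\<^bsub>C\<^esub> element a' b' = element (a \<ominus> a') (b \<ominus> b')"
proof -
  have "(x \<oplus>\<^bsub>C\<^esub> y) \<ominus>\<^bsub>C\<^esub> (z \<oplus>\<^bsub>C\<^esub> w) = (x \<ominus>\<^bsub>C\<^esub> z) \<oplus>\<^bsub>C\<^esub> (y \<ominus>\<^bsub>C\<^esub> w)"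
    if "x \<in> carrier C" "y \<in> carrier C" "z \<in> carrier C" "w \<in> carrier C" for x y z w
    using that by algebra
  then show ?thesis
    by (simp add: element_def \<iota>.hom_diff C.diff_mult)
qed

text \<open>Moving \<open>W\<close> past \<open>a'\<close> and \<open>b'\<close> applies
  \<open>\<sigma>\<close> to them, and W W = 1. The resulting coefficients are the first row of the
  product of the two corresponding matrices.\<close>

lemma element_mult:
  "element a b \<otimes>\<^bsub>C\<^esub> element a' b' = element (a \<otimes> a' \<oplus> b \<otimes> \<sigma> b') (a \<otimes> b' \<oplus> b \<otimes> \<sigma> a')"
proof -
  have "element a b \<otimes>\<^bsub>C\<^esub> element a' b' =
      (\<iota> (a \<otimes> a') \<oplus>\<^bsub>C\<^esub> \<iota> (a \<otimes> b') \<otimes>\<^bsub>C\<^esub> W) \<oplus>\<^bsub>C\<^esub> (\<iota> (b \<otimes> \<sigma> a') \<otimes>\<^bsub>C\<^esub> W \<oplus>\<^bsub>C\<^esub> \<iota> (b \<otimes> \<sigma> b'))"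
    by (simp add: element_def C.l_distr C.r_distr C.m_assoc C.a_ac W_\<iota> W_\<iota>_mult \<iota>.hom_mult)
  then show ?thesis
    by (simp add: element_def \<iota>.hom_add C.l_distr C.a_ac)
qed

end

text \<open>The dual automorphism sends a + b W to a - b W. Sum and difference of the two are 2 a
  and 2 b W, and both are bounded because \<open>\<Phi>\<close> is contractive and
  \<open>\<iota>\<close> isometric.\<close>

lemma nrm_le_nrm_element:
  assumes ab [simp]: "a \<in> carrier A" "b \<in> carrier A"
  shows "nrm A a \<le> nrm C (element a b)" and "nrm A b \<le> nrm C (element a b)"
proof -
  obtain \<Phi> where \<Phi>: "cstar_hom C C \<Phi>" "\<And>a. a \<in> carrier A \<Longrightarrow> \<Phi> (\<iota> a) = \<iota> a" "\<Phi> W = \<ominus>\<^bsub>C\<^esub> W"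
    by (rule dual_automorphism_exists) blast
  interpret \<Phi>: cstar_hom C C \<Phi> by fact
  have \<Phi>_element: "\<Phi> (element a b) = \<iota> a \<ominus>\<^bsub>C\<^esub> \<iota> b \<otimes>\<^bsub>C\<^esub> W"
    by (simp add: element_def \<Phi>.hom_add \<Phi>.hom_mult \<Phi> C.r_minus a_minus_def)
  have two: "x \<oplus>\<^bsub>C\<^esub> x = 2 \<odot>\<^bsub>C\<^esub> x" if "x \<in> carrier C" for x
    using C.smult_add_left[of x 1 1] that by simp
  have "(x \<oplus>\<^bsub>C\<^esub> y) \<oplus>\<^bsub>C\<^esub> (x \<ominus>\<^bsub>C\<^esub> y) = x \<oplus>\<^bsub>C\<^esub> x"
    "(x \<oplus>\<^bsub>C\<^esub> y) \<ominus>\<^bsub>C\<^esub> (x \<ominus>\<^bsub>C\<^esub> y) = y \<oplus>\<^bsub>C\<^esub> y"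
    if "x \<in> carrier C" "y \<in> carrier C" for x y
    using that by algebra+
  then have sum: "element a b \<oplus>\<^bsub>C\<^esub> \<Phi> (element a b) = 2 \<odot>\<^bsub>C\<^esub> \<iota> a"
    and diff: "element a b \<ominus>\<^bsub>C\<^esub> \<Phi> (element a b) = 2 \<odot>\<^bsub>C\<^esub> (\<iota> b \<otimes>\<^bsub>C\<^esub> W)"
    unfolding \<Phi>_element by (simp_all add: element_def two)
  have \<Phi>_le: "nrm C (\<Phi> (element a b)) \<le> nrm C (element a b)"
    by (simp add: \<Phi>.nrm_hom_le)
  have "2 * nrm A a = nrm C (element a b \<oplus>\<^bsub>C\<^esub> \<Phi> (element a b))"
    by (simp add: sum C.nrm_smult nrm_\<iota>)
  also have "\<dots> \<le> 2 * nrm C (element a b)"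
    using C.nrm_add[of "element a b" "\<Phi> (element a b)"] \<Phi>_le by simp
  finally show "nrm A a \<le> nrm C (element a b)"
    by simp
  \<comment> \<open>A second factor \<open>W\<close> removes the first, so the norm of b is at most
    that of b W.\<close>
  have "nrm A b = nrm C (\<iota> b \<otimes>\<^bsub>C\<^esub> W \<otimes>\<^bsub>C\<^esub> W)"
    by (simp add: C.m_assoc nrm_\<iota>)
  also have "\<dots> \<le> nrm C (\<iota> b \<otimes>\<^bsub>C\<^esub> W) * nrm C W"
    by (simp add: C.nrm_mult)
  also have "\<dots> \<le> nrm C (\<iota> b \<otimes>\<^bsub>C\<^esub> W)"
    using nrm_W C.nrm_nonneg[of "\<iota> b \<otimes>\<^bsub>C\<^esub> W"] by (simp add: mult_left_le)
  finally have "2 * nrm A b \<le> nrm C (element a b \<ominus>\<^bsub>C\<^esub> \<Phi> (element a b))"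
    by (simp add: diff C.nrm_smult)
  also have "\<dots> \<le> 2 * nrm C (element a b)"
    using C.nrm_diff[of "element a b" "\<Phi> (element a b)"] \<Phi>_le by simp
  finally show "nrm A b \<le> nrm C (element a b)"
    by simp
qed

lemma element_inject:
  assumes "a \<in> carrier A" "b \<in> carrier A" "a' \<in> carrier A" "b' \<in> carrier A"
    and "element a b = element a' b'"
  shows "a = a' \<and> b = b'"
proof -
  have "element (a \<ominus> a') (b \<ominus> b') = \<zero>\<^bsub>C\<^esub>"
    using assms by (simp flip: element_diff)
  then have "nrm A (a \<ominus> a') = 0" "nrm A (b \<ominus> b') = 0"
    using nrm_le_nrm_element[of "a \<ominus> a'" "b \<ominus> b'"] assms nrm_nonneg[of "a \<ominus> a'"] nrm_nonneg[of "b \<ominus> b'"]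
    by auto
  then show ?thesis
    using assms by (simp add: nrm_eq_0)
qed

section \<open>The normal forms exhaust the crossed product\<close>

definition elements :: "'c set" where
  "elements = {element a b | a b. a \<in> carrier A \<and> b \<in> carrier A}"

lemma elementI: "a \<in> carrier A \<Longrightarrow> b \<in> carrier A \<Longrightarrow> element a b \<in> elements"
  by (auto simp: elements_def)

lemma star_subalgebra_elements: "star_subalgebra elements C"
  unfolding star_subalgebra_def
proof (intro conjI allI ballI)
  \<comment> \<open>Closure under negation becomes an instance of closure under scalars.\<close>
  have neg: "\<ominus>\<^bsub>C\<^esub> x = (-1) \<odot>\<^bsub>C\<^esub> x" if "x \<in> carrier C" for x
    using that by (rule C.minus_eq_smult)
  show "subring elements C"
  proof (rule C.subringI)
    show "\<one>\<^bsub>C\<^esub> \<in> elements"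
      using elementI[of \<one> \<zero>] by (simp add: element_one)
  qed (auto simp: elements_def neg element_smult element_add element_mult;
      metis smult_closed a_closed m_closed \<sigma>.hom_closed)+
qed (auto simp: elements_def element_smult element_star;
    metis smult_closed star_closed \<sigma>.hom_closed)+

text \<open>By \<open>nrm_le_nrm_element\<close> the coefficients of a convergent sequence of normal
  forms are Cauchy in \<open>A\<close>. Their limits give a normal form to which the sequence also
  converges, and limits are unique.\<close>

lemma closedin_elements: "closedin (Metric_space.mtopology (carrier C) (cstar_dist C)) elements"
proof -
  interpret M: Metric_space "carrier C" "cstar_dist C"
    by (rule C.Metric_space_cstar_dist)
  show ?thesis
    unfolding M.metric_closedin_iff_sequentially_closed
  proof (intro conjI allI impI)
    show "elements \<subseteq> carrier C"
      by (auto simp: elements_def)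
    fix s l assume s: "range s \<subseteq> elements \<and> limitin M.mtopology s l sequentially"
    then have "s n \<in> elements" for n
      by blast
    then have "\<forall>n. \<exists>a b. a \<in> carrier A \<and> b \<in> carrier A \<and> s n = element a b"
      unfolding elements_def by blast
    then obtain a b where a [simp]: "\<And>n. a n \<in> carrier A" and b [simp]: "\<And>n. b n \<in> carrier A"
      and s_eq: "\<And>n. s n = element (a n) (b n)"
      by metis
    have l: "l \<in> carrier C" and lim: "(\<lambda>n. nrm C (s n \<ominus>\<^bsub>C\<^esub> l)) \<longlonglongrightarrow> 0"
      using s by (auto simp: M.limitin_metric_dist_null cstar_dist_def s_eq)
    have Cauchy: "\<exists>N. \<forall>m\<ge>N. \<forall>n\<ge>N. nrm C (s m \<ominus>\<^bsub>C\<^esub> s n) < \<epsilon>" if "0 < \<epsilon>" for \<epsilon>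
    proof -
      have "\<forall>\<^sub>F n in sequentially. nrm C (s n \<ominus>\<^bsub>C\<^esub> l) < \<epsilon> / 2"
        using lim that by (intro order_tendstoD) auto
      then obtain N where N: "\<And>n. n \<ge> N \<Longrightarrow> nrm C (s n \<ominus>\<^bsub>C\<^esub> l) < \<epsilon> / 2"
        by (auto simp: eventually_sequentially)
      have "nrm C (s m \<ominus>\<^bsub>C\<^esub> s n) < \<epsilon>" if "m \<ge> N" "n \<ge> N" for m n
        using N[OF that(1)] N[OF that(2)] C.nrm_diff_triangle[of "s m" l "s n"]
          C.nrm_diff_commute[of l "s n"] l by (simp add: s_eq)
      then show ?thesis
        by blast
    qed
    have diff_le: "nrm A (a m \<ominus> a n) \<le> nrm C (s m \<ominus>\<^bsub>C\<^esub> s n)" "nrm A (b m \<ominus> b n) \<le> nrm C (s m \<ominus>\<^bsub>C\<^esub> s n)" for m n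
      unfolding s_eq by (simp_all add: element_diff nrm_le_nrm_element)
    have Cauchy_a: "\<exists>N. \<forall>m\<ge>N. \<forall>n\<ge>N. nrm A (a m \<ominus> a n) < \<epsilon>"
      and Cauchy_b: "\<exists>N. \<forall>m\<ge>N. \<forall>n\<ge>N. nrm A (b m \<ominus> b n) < \<epsilon>" if "0 < \<epsilon>" for \<epsilon>
      using Cauchy[OF that] diff_le by (meson order_le_less_trans)+
    obtain \<alpha> where \<alpha>: "\<alpha> \<in> carrier A" "(\<lambda>n. nrm A (a n \<ominus> \<alpha>)) \<longlonglongrightarrow> 0"
      using Cauchy_imp_convergent[of a, OF a Cauchy_a] by metis
    obtain \<beta> where \<beta>: "\<beta> \<in> carrier A" "(\<lambda>n. nrm A (b n \<ominus> \<beta>)) \<longlonglongrightarrow> 0"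
      using Cauchy_imp_convergent[of b, OF b Cauchy_b] by metis
    have "l = element \<alpha> \<beta>"
    proof (rule C.limit_unique[of s, OF _ l _ lim])
      have le: "nrm C (s n \<ominus>\<^bsub>C\<^esub> element \<alpha> \<beta>) \<le> nrm A (a n \<ominus> \<alpha>) + nrm A (b n \<ominus> \<beta>)" for n
      proof -
        have "nrm C (s n \<ominus>\<^bsub>C\<^esub> element \<alpha> \<beta>)
            \<le> nrm C (\<iota> (a n \<ominus> \<alpha>)) + nrm C (\<iota> (b n \<ominus> \<beta>) \<otimes>\<^bsub>C\<^esub> W)"
          unfolding s_eq using \<alpha>(1) \<beta>(1)
          by (simp add: element_diff) (simp add: element_def C.nrm_add)
        also have "nrm C (\<iota> (b n \<ominus> \<beta>) \<otimes>\<^bsub>C\<^esub> W) \<le> nrm A (b n \<ominus> \<beta>) * nrm C W"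
          using C.nrm_mult[of "\<iota> (b n \<ominus> \<beta>)" W] \<beta>(1) by (simp add: nrm_\<iota>)
        also have "\<dots> \<le> nrm A (b n \<ominus> \<beta>)"
          using nrm_W nrm_nonneg[of "b n \<ominus> \<beta>"] \<beta>(1) by (simp add: mult_left_le)
        finally show ?thesis
          using \<alpha>(1) by (simp add: nrm_\<iota>)
      qed
      have lim': "(\<lambda>n. nrm A (a n \<ominus> \<alpha>) + nrm A (b n \<ominus> \<beta>)) \<longlonglongrightarrow> 0"
        using tendsto_add[OF \<alpha>(2) \<beta>(2)] by simp
      show "(\<lambda>n. nrm C (s n \<ominus>\<^bsub>C\<^esub> element \<alpha> \<beta>)) \<longlonglongrightarrow> 0"
      proof (rule tendsto_sandwich[OF _ _ tendsto_const lim'])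
        show "\<forall>\<^sub>F n in sequentially. 0 \<le> nrm C (s n \<ominus>\<^bsub>C\<^esub> element \<alpha> \<beta>)"
          using \<alpha>(1) \<beta>(1) by (simp add: s_eq C.nrm_nonneg)
      qed (simp add: le)
    qed (use \<alpha>(1) \<beta>(1) in \<open>auto simp: s_eq\<close>)
    then show "l \<in> elements"
      using \<alpha>(1) \<beta>(1) by (simp add: elementI)
  qed
qed

text \<open>\<open>elements\<close> is one of the closed subalgebras containing the generators, so
  the generated algebra, which is all of \<open>C\<close>, lies in it.\<close>

lemma carrier_eq_elements: "carrier C = elements"
proof
  show "elements \<subseteq> carrier C"
    by (auto simp: elements_def)
  have "insert W (\<iota> ` carrier A) \<subseteq> elements"
    using elementI[of \<zero> \<one>] elementI[of _ \<zero>] by (auto simp: element_zero_one element_zero_right)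
  then have "cstar_generated C (insert W (\<iota> ` carrier A)) \<subseteq> elements"
    unfolding cstar_generated_def using star_subalgebra_elements closedin_elements by blast
  then show "carrier C \<subseteq> elements"
    using crossed_product by (simp add: crossed_product_Z2_def)
qed

section \<open>The isomorphism onto the twisted matrices\<close>

abbreviation "twisted a b \<equiv> mat2 a b (\<sigma> b) (\<sigma> a)"

text \<open>The description is definite on all of \<open>C\<close>: coefficients exist by
  \<open>carrier_eq_elements\<close> and are unique by \<open>element_inject\<close>.\<close>

definition to_matrix :: "'c \<Rightarrow> 'a ^ 2 ^ 2" where
  "to_matrix x = (THE P. \<exists>a\<in>carrier A. \<exists>b\<in>carrier A. x = element a b \<and> P = twisted a b)"

lemma to_matrix_element:
  assumes "a \<in> carrier A" "b \<in> carrier A"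
  shows "to_matrix (element a b) = twisted a b"
  unfolding to_matrix_def
proof (rule the_equality)
  show "\<exists>a'\<in>carrier A. \<exists>b'\<in>carrier A. element a b = element a' b' \<and> twisted a b = twisted a' b'"
    using assms by blast
  fix P assume "\<exists>a'\<in>carrier A. \<exists>b'\<in>carrier A. element a b = element a' b' \<and> P = twisted a' b'"
  then show "P = twisted a b"
    using element_inject[OF assms] by blast
qed

text \<open>The operations on normal forms match the first rows of the matrices. The second rows
  then agree because \<open>\<sigma>\<close> is an involutive morphism, up to the order of summands.
  Bijectivity holds since both sides are parametrised by the pair of coefficients.\<close>

lemma to_matrix_star_iso: "to_matrix \<in> star_iso C (twisted_matrix_alg A \<sigma>)"
  unfolding star_iso_def
proof (intro CollectI conjI)
  show "to_matrix \<in> star_hom C (twisted_matrix_alg A \<sigma>)"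
    unfolding star_hom_def ring_hom_def carrier_eq_elements elements_def
    by (auto simp: element_mult element_add element_smult element_star element_one[symmetric]
          to_matrix_element twisted_matrix_alg_def twisted_matrices_def mat2_one
          \<sigma>.hom_add \<sigma>.hom_mult \<sigma>.hom_smult \<sigma>.hom_star a_comm)
  show "bij_betw to_matrix (carrier C) (carrier (twisted_matrix_alg A \<sigma>))"
  proof (rule bij_betw_imageI)
    show "inj_on to_matrix (carrier C)"
      by (rule inj_onI) (auto simp: carrier_eq_elements elements_def to_matrix_element)
    show "to_matrix ` carrier C = carrier (twisted_matrix_alg A \<sigma>)"
      by (auto simp: carrier_eq_elements elements_def to_matrix_element twisted_matrix_alg_def
          twisted_matrices_def image_iff) (metis to_matrix_element)
  qed
qed

lemma star_subalgebra_twisted_matrices: "star_subalgebra (twisted_matrices A \<sigma>) (mat2_alg A)"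
proof -
  \<comment> \<open>The lower row enters through equations, so applying the rule leaves identities
    for \<open>\<sigma>\<close> instead of requiring a syntactic match.\<close>
  have mem: "mat2 a b c d \<in> twisted_matrices A \<sigma>"
    if "a \<in> carrier A" "b \<in> carrier A" "c = \<sigma> b" "d = \<sigma> a" for a b c d
    using that by (auto simp: twisted_matrices_def)
  have cases: "\<exists>a\<in>carrier A. \<exists>b\<in>carrier A. P = twisted a b"
    if "P \<in> twisted_matrices A \<sigma>" for P
    using that by (auto simp: twisted_matrices_def)
  have subset: "twisted_matrices A \<sigma> \<subseteq> carrier (mat2_alg A)"
    by (auto dest!: cases)
  have add: "P \<oplus>\<^bsub>mat2_alg A\<^esub> Q \<in> twisted_matrices A \<sigma>"
    and mult: "P \<otimes>\<^bsub>mat2_alg A\<^esub> Q \<in> twisted_matrices A \<sigma>"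
    if "P \<in> twisted_matrices A \<sigma>" "Q \<in> twisted_matrices A \<sigma>" for P Q
    using that by (auto dest!: cases simp: \<sigma>.hom_add \<sigma>.hom_mult a_comm intro!: mem)
  have minus: "\<ominus>\<^bsub>mat2_alg A\<^esub> P \<in> twisted_matrices A \<sigma>" if "P \<in> twisted_matrices A \<sigma>" for P
    using that by (auto dest!: cases simp: mat2_minus \<sigma>.hom_minus intro!: mem)
  have "subring (twisted_matrices A \<sigma>) (mat2_alg A)"
    unfolding subring_def
  proof
    show "subgroup (twisted_matrices A \<sigma>) (add_monoid (mat2_alg A))"
      using subset add minus mem[of \<zero> \<zero>] by unfold_locales (auto simp: mat2_zero a_inv_def)
    show "submonoid (twisted_matrices A \<sigma>) (mat2_alg A)"
      using subset mult mem[of \<one> \<zero>] by unfold_locales (auto simp: mat2_one)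
  qed
  then show ?thesis
    unfolding star_subalgebra_def
    by (auto dest!: cases simp: \<sigma>.hom_smult \<sigma>.hom_star intro!: mem)
qed

text \<open>Every element of \<open>C\<close> is exactly a + b W, so its image is computed from
  those of the generators without any continuity argument.\<close>

lemma star_hom_unique:
  assumes \<Psi>: "\<Psi> \<in> star_hom C (twisted_matrix_alg A \<sigma>)"
    and gens: "\<And>a. a \<in> carrier A \<Longrightarrow> \<Psi> (\<iota> a) = mat2 a \<zero> \<zero> (\<sigma> a)"
      "\<Psi> W = mat2 \<zero> \<one> \<one> \<zero>"
    and x: "x \<in> carrier C"
  shows "\<Psi> x = to_matrix x"
proof -
  obtain a b where ab: "a \<in> carrier A" "b \<in> carrier A" and x_eq: "x = element a b"
    using x by (auto simp: carrier_eq_elements elements_def)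
  have "\<Psi> x = \<Psi> (\<iota> a) \<oplus>\<^bsub>mat2_alg A\<^esub> \<Psi> (\<iota> b) \<otimes>\<^bsub>mat2_alg A\<^esub> \<Psi> W"
    using \<Psi> ab by (simp add: x_eq element_def star_hom_def ring_hom_def twisted_matrix_alg_def)
  also have "\<dots> = twisted a b"
    using ab by (simp add: gens)
  finally show ?thesis
    using ab by (simp add: x_eq to_matrix_element)
qed

end

theorem proposition2p2:
  fixes A :: "'a cstar" and \<sigma> :: "'a \<Rightarrow> 'a"
    and C :: "'c cstar" and \<iota> :: "'a \<Rightarrow> 'c" and W :: 'c
  assumes "cstar_algebra A"
    and "order_two_star_automorphism A \<sigma>"
    and "crossed_product_Z2 A \<sigma> C \<iota> W"
  shows "star_subalgebra (twisted_matrices A \<sigma>) (mat2_alg A) \<and>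
    (\<exists>\<Phi> \<in> star_iso C (twisted_matrix_alg A \<sigma>).
       (\<forall>a \<in> carrier A. \<Phi> (\<iota> a) = mat2 a \<zero>\<^bsub>A\<^esub> \<zero>\<^bsub>A\<^esub> (\<sigma> a)) \<and>
       \<Phi> W = mat2 \<zero>\<^bsub>A\<^esub> \<one>\<^bsub>A\<^esub> \<one>\<^bsub>A\<^esub> \<zero>\<^bsub>A\<^esub> \<and>
       (\<forall>\<Psi> \<in> star_hom C (twisted_matrix_alg A \<sigma>).
          (\<forall>a \<in> carrier A. \<Psi> (\<iota> a) = mat2 a \<zero>\<^bsub>A\<^esub> \<zero>\<^bsub>A\<^esub> (\<sigma> a)) \<and>
          \<Psi> W = mat2 \<zero>\<^bsub>A\<^esub> \<one>\<^bsub>A\<^esub> \<one>\<^bsub>A\<^esub> \<zero>\<^bsub>A\<^esub> \<longrightarrow>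
          (\<forall>x \<in> carrier C. \<Psi> x = \<Phi> x)))"
proof -
  interpret Z2_crossed_product A \<sigma> C \<iota> W
    by (intro Z2_crossed_product.intro Z2_crossed_product_axioms.intro assms)
  show ?thesis
  proof (intro conjI bexI[of _ to_matrix] ballI impI)
    show "star_subalgebra (twisted_matrices A \<sigma>) (mat2_alg A)"
      by (rule star_subalgebra_twisted_matrices)
    show "to_matrix \<in> star_iso C (twisted_matrix_alg A \<sigma>)"
      by (rule to_matrix_star_iso)
    show "to_matrix (\<iota> a) = mat2 a \<zero>\<^bsub>A\<^esub> \<zero>\<^bsub>A\<^esub> (\<sigma> a)" if "a \<in> carrier A" for a
      using that to_matrix_element[of a "\<zero>\<^bsub>A\<^esub>"] by (simp add: element_zero_right)
    show "to_matrix W = mat2 \<zero>\<^bsub>A\<^esub> \<one>\<^bsub>A\<^esub> \<one>\<^bsub>A\<^esub> \<zero>\<^bsub>A\<^esub>"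
      using to_matrix_element[of "\<zero>\<^bsub>A\<^esub>" "\<one>\<^bsub>A\<^esub>"] by (simp add: element_zero_one)
  qed (rule star_hom_unique, simp_all)
qed

end
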